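(* Let $n\ge1$ be an integer, $\beta>0$, $\rho,\eta\in\mathbb{R}$ and $1\le p,q\le\infty$. (i) If $\ell\ge1$ and the embedding $F^{p}_{\beta,\rho}\hookrightarrow F^{q}_{\beta,\eta}$ holds, then $\rho\ge\eta$. (ii) For $\ell=1$, the embedding $F^{p}_{\beta,\rho}\hookrightarrow F^{q}_{\beta,\rho}$ holds if and only if $p\le q$. (iii) For $\ell>1$, the embedding $F^{p}_{\beta,\rho}\hookrightarrow F^{q}_{\beta,\rho}$ holds if and only if $p=q$.
   Context: $dV$ is Lebesgue measure on $\mathbb{C}^n$ normalized so that the unit ball has measure 1. For $1\le p<\infty$, $\alpha>0$, $\rho\in\mathbb{R}$, $F^p_{\alpha,\rho}$ (depending also on $\ell$) is the space of entire functions $f$ on $\mathbb{C}^n$ with $\|f\|^p_{F^p_{\alpha,\rho}}=\int_{\mathbb{C}^n}\bigl|f(z)(1+|z|)^{\rho}e^{-\frac{\alpha}{2}|z|^{2\ell}}\bigr|^p\,dV(z)<\infty$; $F^\infty_{\alpha,\rho}$ is the space of entire $f$ with $\|f\|_{F^\infty_{\alpha,\rho}}=\sup_{z}|f(z)|(1+|z|)^\rho e^{-\frac{\alpha}{2}|z|^{2\ell}}<\infty$. For normed spaces $X,Y$, $X\hookrightarrow Y$ means that $X\subset Y$ and the inclusion map is bounded. *)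

theory Defs
  imports "HOL-Analysis.Analysis"
begin

text \<open>Holomorphy in several variables: real Frechet differentiability with a derivative
  that is linear over the complex numbers (\<^term>\<open>c *s v\<close> is the scalar multiplication of
  the complex vector space).\<close>

definition entire :: "(complex ^ 'n \<Rightarrow> complex) \<Rightarrow> bool" where
  "entire f \<longleftrightarrow> (\<forall>z. \<exists>L. (f has_derivative L) (at z) \<and> (\<forall>c v. L (c *s v) = c * L v))"

definition dV :: "(complex ^ 'n) measure" where
  "dV = scale_measure (1 / emeasure lborel (ball (0 :: complex ^ 'n) 1)) lborel"

lemma emeasure_dV_unit_ball: "emeasure (dV :: (complex^'n) measure) (ball 0 1) = 1"
proof -
  have 1: "emeasure lborel (ball (0::complex^'n) 1) < \<infinity>" using emeasure_bounded_finite by blast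
  have 2: "emeasure lborel (ball (0::complex^'n) 1) \<noteq> 0"
    using less_imp_neq[OF Gamma_real_pos[of "real CARD('n)+1"]] by (auto simp add: emeasure_ball unit_ball_vol_def)
  show ?thesis unfolding dV_def using 1 2
   by (simp add: ennreal_divide_times ennreal_divide_self top.not_eq_extremum)
qed

definition weighted_abs ::
    "real \<Rightarrow> real \<Rightarrow> real \<Rightarrow> (complex ^ 'n \<Rightarrow> complex) \<Rightarrow> complex ^ 'n \<Rightarrow> real" where
  "weighted_abs l \<alpha> \<rho> f z =
     norm (f z) * (1 + norm z) powr \<rho> * exp (- (\<alpha> / 2) * norm z powr (2 * l))"

text \<open>The exponent \<open>p\<close> ranges over the extended nonnegative reals, so that \<open>1 \<le> p\<close> means
  \<open>1 \<le> p \<le> \<infinity>\<close>. The value of \<open>fock_norm\<close> is meaningful only on \<open>fock_space\<close>.\<close>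

definition fock_space ::
    "real \<Rightarrow> real \<Rightarrow> real \<Rightarrow> ennreal \<Rightarrow> (complex ^ 'n \<Rightarrow> complex) set" where
  "fock_space l \<alpha> \<rho> p = {f. entire f \<and>
     (if p = \<infinity> then bdd_above (range (weighted_abs l \<alpha> \<rho> f))
      else (\<integral>\<^sup>+ z. ennreal (weighted_abs l \<alpha> \<rho> f z powr enn2real p) \<partial>dV) < \<infinity>)}"

definition fock_norm ::
    "real \<Rightarrow> real \<Rightarrow> real \<Rightarrow> ennreal \<Rightarrow> (complex ^ 'n \<Rightarrow> complex) \<Rightarrow> real" where
  "fock_norm l \<alpha> \<rho> p f =
     (if p = \<infinity> then (SUP z. weighted_abs l \<alpha> \<rho> f z)
      else enn2real (\<integral>\<^sup>+ z. ennreal (weighted_abs l \<alpha> \<rho> f z powr enn2real p) \<partial>dV)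
             powr (1 / enn2real p))"

text \<open>Bounded inclusion of a space \<open>X\<close> with norm \<open>nX\<close> into a space \<open>Y\<close> with norm \<open>nY\<close>.\<close>

definition embeds :: "'a set \<Rightarrow> ('a \<Rightarrow> real) \<Rightarrow> 'a set \<Rightarrow> ('a \<Rightarrow> real) \<Rightarrow> bool" where
  "embeds X nX Y nY \<longleftrightarrow> X \<subseteq> Y \<and> (\<exists>C. \<forall>f\<in>X. nY f \<le> C * nX f)"

definition fock_embeds ::
    "'n::finite itself \<Rightarrow> real \<Rightarrow> real \<Rightarrow> real \<Rightarrow> ennreal \<Rightarrow> real \<Rightarrow> ennreal \<Rightarrow> bool" where
  "fock_embeds _ l \<beta> \<rho> p \<eta> q \<longleftrightarrow>
     embeds (fock_space l \<beta> \<rho> p :: (complex ^ 'n \<Rightarrow> complex) set) (fock_norm l \<beta> \<rho> p)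
            (fock_space l \<beta> \<eta> q) (fock_norm l \<beta> \<eta> q)"

end

theory Submission
  imports Defs "HOL-Complex_Analysis.Cauchy_Integral_Formula" "HOL-Real_Asymp.Real_Asymp"
begin

text \<open>Write \<open>n\<close> for the complex dimension. The exponential of a linear function with its weighted peak
  at \<open>(R, 0, \<dots>, 0)\<close> lives on a ball of radius \<open>R\<^sup>1\<^sup>-\<^sup>l\<close>, and comparing norms as \<open>R \<rightarrow> \<infinity>\<close> shows that
  an embedding forces \<open>\<eta> - 2n(l-1)/q \<le> \<rho> - 2n(l-1)/p\<close>; this settles \<open>p \<le> q\<close>.

  For \<open>q < p\<close> one needs functions that are spread out. The monomials with exponents \<open>(m i)\<^sup>2\<close>,
  \<open>J \<le> m i \<le> 2J\<close>, suitably normalised, are in weighted modulus Gaussians at unit scale around the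
  integer points in the coordinates \<open>|z|\<^sup>l\<^sup>-\<^sup>1 |z\<^sub>i|\<close>. All sums of subsets of them are therefore uniformly bounded,
  while on a set of volume of order \<open>J\<^sup>2\<^sup>n\<^sup>/\<^sup>l\<close> a random subset sum is bounded below. Since by
  Hoelder's inequality the supremum norm with weight exponent slightly above \<open>\<rho> + 2n/p\<close>
  controls the norm of \<open>F\<^sup>p\<close> with weight exponent \<open>\<rho>\<close>, this gives \<open>\<eta> + 2n/q \<le> \<rho> + 2n/p\<close>.

  Conversely, for \<open>l = 1\<close> the sub-mean value property on unit balls yields a pointwise bound by the
  \<open>p\<close>-norm, from which the case \<open>p \<le> q\<close> follows by interpolation.\<close>

subsection \<open>Entire functions and the measure\<close>

text \<open>Peaks alone cannot rule out q < p: for l = 1 their condition at equal weights is void,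
  and for l > 1 it holds whenever q \<le> p. What is needed there is a weighted modulus that is
  nearly flat on a large set. Squares as exponents come from the width of a monomial's peak. In the
  coordinates log |z_i| the gradient of the weight (\<beta>/2) |z|^(2l) is \<beta> l |z|^(2l-2)
  |z_i|^2, so a monomial with exponents k_i peaks where this equals k_i, with fluctuations of order
  sqrt k_i. After taking square roots the width is of order one wherever the peak lies, and k_i =
  (m_i)^2 puts the centres on the integer lattice. That is sparse enough for the absolute values to
  have a bounded sum, so the upper bound uses no cancellation, and dense enough for every point of
  the region to be close to a centre. Randomness serves only the lower bound, where neighbouring
  monomials might cancel. Throughout, \<open>enn2real\<close> sends infinity to 0 and division by 0
  gives 0, so \<open>1 / enn2real p\<close> is the right reading of 1/p at infinity too.\<close>

lemma entire_const: "entire (\<lambda>z. c)"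
  unfolding entire_def by (auto intro!: exI[of _ "\<lambda>_. 0"])

lemma entire_nth: "entire (\<lambda>z. z $ i)"
  unfolding entire_def
  by (auto intro!: exI[of _ "\<lambda>v. v $ i"] bounded_linear_imp_has_derivative bounded_linear_vec_nth)

lemma entire_add:
  assumes "entire f" "entire g"
  shows "entire (\<lambda>z. f z + g z)"
  unfolding entire_def
proof
  fix z
  obtain L where L: "(f has_derivative L) (at z)" "\<forall>c v. L (c *s v) = c * L v"
    using assms(1) unfolding entire_def by blast
  obtain M where M: "(g has_derivative M) (at z)" "\<forall>c v. M (c *s v) = c * M v"
    using assms(2) unfolding entire_def by blast
  show "\<exists>K. ((\<lambda>z. f z + g z) has_derivative K) (at z) \<and> (\<forall>c v. K (c *s v) = c * K v)"
    using L M by (intro exI[of _ "\<lambda>v. L v + M v"]) (auto intro!: derivative_intros simp: algebra_simps)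
qed

lemma entire_mult:
  assumes "entire f" "entire g"
  shows "entire (\<lambda>z. f z * g z)"
  unfolding entire_def
proof
  fix z
  obtain L where L: "(f has_derivative L) (at z)" "\<forall>c v. L (c *s v) = c * L v"
    using assms(1) unfolding entire_def by blast
  obtain M where M: "(g has_derivative M) (at z)" "\<forall>c v. M (c *s v) = c * M v"
    using assms(2) unfolding entire_def by blast
  show "\<exists>K. ((\<lambda>z. f z * g z) has_derivative K) (at z) \<and> (\<forall>c v. K (c *s v) = c * K v)"
    using L M has_derivative_mult[OF L(1) M(1)]
    by (intro exI[of _ "\<lambda>v. f z * M v + L v * g z"]) (auto simp: algebra_simps)
qed

lemma entire_exp:
  assumes "entire f"
  shows "entire (\<lambda>z. exp (f z))"
  unfolding entire_def
proof
  fix z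
  obtain L where L: "(f has_derivative L) (at z)" "\<forall>c v. L (c *s v) = c * L v"
    using assms(1) unfolding entire_def by blast
  have "((\<lambda>z. exp (f z)) has_derivative (\<lambda>v. exp (f z) * L v)) (at z)"
    using has_derivative_compose[OF L(1), of exp "\<lambda>v. exp (f z) * v"] DERIV_exp[of "f z"]
    by (simp add: has_field_derivative_def)
  then show "\<exists>K. ((\<lambda>z. exp (f z)) has_derivative K) (at z) \<and> (\<forall>c v. K (c *s v) = c * K v)"
    using L by (intro exI[of _ "\<lambda>v. exp (f z) * L v"]) auto
qed

lemma entire_sum: "(\<And>i. i \<in> A \<Longrightarrow> entire (f i)) \<Longrightarrow> entire (\<lambda>z. \<Sum>i\<in>A. f i z)"
  by (induction A rule: infinite_finite_induct) (auto intro: entire_const entire_add)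

lemma entire_prod: "(\<And>i. i \<in> A \<Longrightarrow> entire (f i)) \<Longrightarrow> entire (\<lambda>z. \<Prod>i\<in>A. f i z)"
  by (induction A rule: infinite_finite_induct) (auto intro: entire_const entire_mult)

lemma entire_power: "entire f \<Longrightarrow> entire (\<lambda>z. f z ^ k)"
  by (induction k) (auto intro: entire_const entire_mult)

lemma entire_continuous_on: "entire f \<Longrightarrow> continuous_on A f"
  unfolding entire_def
  by (meson continuous_at_imp_continuous_on has_derivative_continuous)

lemma entire_measurable: "entire f \<Longrightarrow> f \<in> borel_measurable borel"
  by (intro borel_measurable_continuous_onI entire_continuous_on)

section \<open>Scalar multiples and restriction to complex lines\<close>

lemma bounded_linear_vector_smult_left: "bounded_linear (\<lambda>c. c *s (u :: complex ^ 'n))"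
proof (intro bounded_linearI')
  fix x y :: complex and r :: real
  show "(x + y) *s u = x *s u + y *s u" by (simp add: vec_eq_iff algebra_simps)
  show "(r *\<^sub>R x) *s u = r *\<^sub>R (x *s u)" by (simp add: vec_eq_iff)
qed

lemma norm_vector_smult: "norm (c *s (u :: complex ^ 'n)) = norm c * norm u"
  by (simp add: norm_vec_def L2_set_def norm_mult power_mult_distrib flip: sum_distrib_left)
     (simp add: real_sqrt_mult)

text \<open>Complex linearity of the Frechet derivative turns the real derivative along a complex
  line into a complex one, which gives access to one-variable Cauchy theory.\<close>

lemma entire_on_line:
  assumes "entire f"
  shows "(\<lambda>t. f (w + t *s u)) holomorphic_on A"
proof -
  have "(\<lambda>t. f (w + t *s u)) field_differentiable at t" for t
  proof -
    obtain L where L: "(f has_derivative L) (at (w + t *s u))" "\<forall>c v. L (c *s v) = c * L v"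
      using assms unfolding entire_def by blast
    have "((\<lambda>t. w + t *s u) has_derivative (\<lambda>t. t *s u)) (at t)"
      by (auto intro!: derivative_eq_intros bounded_linear_imp_has_derivative bounded_linear_vector_smult_left)
    from has_derivative_compose[OF this L(1)]
    have "((\<lambda>t. f (w + t *s u)) has_derivative (\<lambda>t. t * L u)) (at t)" using L(2) by simp
    then have "((\<lambda>t. f (w + t *s u)) has_field_derivative L u) (at t)"
      by (simp add: has_field_derivative_def mult_commute_abs)
    then show ?thesis by (auto simp: field_differentiable_def)
  qed
  then show ?thesis
    by (auto simp: holomorphic_on_def intro: field_differentiable_at_within)
qed

section \<open>Normalised Lebesgue measure: balls, dilations, rotations\<close>

lemma sets_dV [simp, measurable_cong]: "sets (dV :: (complex ^ 'n) measure) = sets borel"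
  by (simp add: dV_def)

lemma space_dV [simp]: "space (dV :: (complex ^ 'n) measure) = UNIV"
  by (simp add: dV_def space_scale_measure)

lemma sets_borel_ball [measurable]: "ball (x :: 'a :: metric_space) r \<in> sets borel"
  by simp

lemma borel_measurable_dV [simp]: "borel_measurable (dV :: (complex ^ 'n) measure) = borel_measurable borel"
  by (rule measurable_cong_sets) simp_all

lemma nn_integral_dV:
  assumes [measurable]: "f \<in> borel_measurable borel"
  shows "(\<integral>\<^sup>+z. f z \<partial>(dV :: (complex ^ 'n) measure)) = 1 / emeasure lborel (ball (0 :: complex ^ 'n) 1) * (\<integral>\<^sup>+z. f z \<partial>lborel)"
  unfolding dV_def by (rule nn_integral_scale_measure) simp

lemma emeasure_dV_ball:
  fixes w :: "complex ^ 'n"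
  assumes "0 \<le> r"
  shows "emeasure dV (ball w r) = ennreal (r ^ (2 * CARD('n)))"
proof -
  let ?V = "unit_ball_vol (real (2 * CARD('n)))"
  have V: "?V > 0" by (rule unit_ball_vol_pos) simp
  have "emeasure lborel (ball w r) = ennreal (?V * r ^ (2 * CARD('n)))"
       "emeasure lborel (ball (0 :: complex ^ 'n) 1) = ennreal ?V"
    using assms by (simp_all add: emeasure_ball mult.commute)
  then have "emeasure dV (ball w r) = 1 / ennreal ?V * ennreal (?V * r ^ (2 * CARD('n)))"
    by (simp add: dV_def)
  also have "\<dots> = ennreal (r ^ (2 * CARD('n)))"
    using V assms by (simp add: divide_ennreal ennreal_mult'[symmetric] less_imp_neq[symmetric] del: of_nat_mult flip: ennreal_1)
  finally show ?thesis .
qed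

text \<open>With s = \<open>R powr (l - 1)\<close> this reduces integrals over shrinking peaks to
  one fixed integral. The Jacobian is written with \<open>powr\<close> so that the exponents of R
  combine later.\<close>

lemma nn_integral_dV_affine:
  fixes w :: "complex ^ 'n" and f :: "complex ^ 'n \<Rightarrow> ennreal"
  assumes "0 < s" and [measurable]: "f \<in> borel_measurable borel"
  shows "(\<integral>\<^sup>+z. f (s *\<^sub>R (z - w)) \<partial>dV) = ennreal (s powr - real (2 * CARD('n))) * (\<integral>\<^sup>+z. f z \<partial>dV)"
proof -
  let ?d = "2 * CARD('n)"
  have "(\<integral>\<^sup>+z. f z \<partial>lborel) =
      (\<integral>\<^sup>+z. f z \<partial>density (distr lborel borel (\<lambda>z. - (s *\<^sub>R w) + s *\<^sub>R z)) (\<lambda>_. ennreal (\<bar>s\<bar> ^ DIM(complex ^ 'n))))"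
    using assms(1) by (subst lborel_affine[of s "- (s *\<^sub>R w)"]) auto
  also have "\<dots> = (\<integral>\<^sup>+z. ennreal (s ^ ?d) * f (s *\<^sub>R (z - w)) \<partial>lborel)"
    using assms(1) by (simp add: nn_integral_density nn_integral_distr algebra_simps)
  also have "\<dots> = ennreal (s ^ ?d) * (\<integral>\<^sup>+z. f (s *\<^sub>R (z - w)) \<partial>lborel)"
    by (intro nn_integral_cmult) simp
  finally have eq: "(\<integral>\<^sup>+z. f z \<partial>lborel) = ennreal (s ^ ?d) * (\<integral>\<^sup>+z. f (s *\<^sub>R (z - w)) \<partial>lborel)" .
  have "ennreal (s powr - real ?d) * ennreal (s ^ ?d) = 1"
    using assms(1) by (simp add: ennreal_mult'[symmetric] powr_minus powr_realpow flip: of_nat_mult)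
  then have "(\<integral>\<^sup>+z. f (s *\<^sub>R (z - w)) \<partial>lborel) = ennreal (s powr - real ?d) * (\<integral>\<^sup>+z. f z \<partial>lborel)"
    unfolding eq by (simp flip: mult.assoc)
  then show ?thesis by (simp add: nn_integral_dV mult_ac)
qed

text \<open>A translation invariant measure that agrees with Lebesgue measure on one set of finite
  positive measure is Lebesgue measure: evaluate the double integral of
  \<open>1\<^sub>B(x) 1\<^sub>A(x + y)\<close> in both orders.\<close>

lemma translation_invariant_eq_lborel:
  fixes M :: "('a :: euclidean_space) measure"
  assumes "sigma_finite_measure M" and sets [measurable_cong]: "sets M = sets borel"
    and inv: "\<And>y A. A \<in> sets borel \<Longrightarrow> emeasure M ((\<lambda>x. x + y) -` A) = emeasure M A"
    and B: "B \<in> sets borel" "emeasure M B = emeasure lborel B" "emeasure lborel B \<noteq> 0" "emeasure lborel B < \<infinity>"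
      "\<And>x. - x \<in> B \<longleftrightarrow> x \<in> B"
  shows "M = lborel"
proof (rule measure_eqI)
  show "sets M = sets lborel" using sets by simp
  fix A assume "A \<in> sets M"
  then have A[measurable]: "A \<in> sets borel" using sets by simp
  note B(1)[measurable]
  interpret M: sigma_finite_measure M by fact
  interpret P: pair_sigma_finite M lborel by unfold_locales
  have sp: "space M = UNIV" using sets_eq_imp_space_eq[OF sets] by simp
  have inv': "(\<integral>\<^sup>+x. f x \<partial>M) = (\<integral>\<^sup>+x. f (x - y) \<partial>M)" if [measurable]: "f \<in> borel_measurable borel" for f y
  proof -
    have "M = distr M borel (\<lambda>x. x + (- y))"
      using inv[of _ "- y"] sets sp by (intro measure_eqI) (auto simp: emeasure_distr)
    then have "(\<integral>\<^sup>+x. f x \<partial>M) = (\<integral>\<^sup>+x. f x \<partial>distr M borel (\<lambda>x. x + (- y)))" by metis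
    then show ?thesis by (simp add: nn_integral_distr)
  qed
  have invl: "(\<integral>\<^sup>+x. f x \<partial>lborel) = (\<integral>\<^sup>+x. f (y + x) \<partial>lborel)" if [measurable]: "f \<in> borel_measurable borel"
    for f and y :: 'a
    by (subst lborel_distr_plus[of y, symmetric]) (simp add: nn_integral_distr)
  have invn: "(\<integral>\<^sup>+x. f x \<partial>lborel) = (\<integral>\<^sup>+x. f (y - x) \<partial>lborel)" if [measurable]: "f \<in> borel_measurable borel"
    for f and y :: 'a
    by (subst lborel_affine[of "- 1" y]) (auto simp: nn_integral_distr nn_integral_density)
  have "emeasure M B * emeasure lborel A = (\<integral>\<^sup>+x. indicator B x * emeasure lborel A \<partial>M)"
    by (simp add: nn_integral_multc)
  also have "\<dots> = (\<integral>\<^sup>+x. (\<integral>\<^sup>+y. indicator B x * indicator A (x + y) \<partial>lborel) \<partial>M)"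
    by (intro nn_integral_cong) (simp add: nn_integral_cmult invl[of "indicator A", symmetric])
  also have "\<dots> = (\<integral>\<^sup>+y. (\<integral>\<^sup>+x. indicator B x * indicator A (x + y) \<partial>M) \<partial>lborel)"
    by (rule P.Fubini'[symmetric]) measurable
  also have "\<dots> = (\<integral>\<^sup>+y. (\<integral>\<^sup>+x. indicator B (x - y) * indicator A x \<partial>M) \<partial>lborel)"
  proof (rule nn_integral_cong)
    fix y :: 'a
    show "(\<integral>\<^sup>+x. indicator B x * (indicator A (x + y) :: ennreal) \<partial>M) = (\<integral>\<^sup>+x. indicator B (x - y) * indicator A x \<partial>M)"
      by (subst inv'[of _ y]) simp_all
  qed
  also have "\<dots> = (\<integral>\<^sup>+x. (\<integral>\<^sup>+y. indicator B (x - y) * indicator A x \<partial>lborel) \<partial>M)"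
    by (rule P.Fubini') measurable
  also have "\<dots> = (\<integral>\<^sup>+x. emeasure lborel B * indicator A x \<partial>M)"
    by (intro nn_integral_cong) (simp add: nn_integral_multc invn[of "indicator B", symmetric])
  also have "\<dots> = emeasure lborel B * emeasure M A"
    by (simp add: nn_integral_cmult)
  finally show "emeasure M A = emeasure lborel A"
    using B(2,3,4) by (auto simp: ennreal_mult_cancel_left)
qed

text \<open>The image of Lebesgue measure under \<open>u \<mapsto> c *s u\<close> is again
  translation invariant, and the unit ball keeps its mass because the map is an isometry. By
  uniqueness the image is Lebesgue measure, without computing a real determinant.\<close>

lemma nn_integral_lborel_rotate:
  fixes f :: "complex ^ 'n \<Rightarrow> ennreal"
  assumes c: "norm c = 1" and [measurable]: "f \<in> borel_measurable borel"
  shows "(\<integral>\<^sup>+u. f (c *s u) \<partial>lborel) = (\<integral>\<^sup>+u. f u \<partial>lborel)"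
proof -
  have [measurable]: "(\<lambda>u. c *s u) \<in> borel_measurable (borel :: (complex ^ 'n) measure)"
  proof -
    have "bounded_linear (\<lambda>u :: complex ^ 'n. c *s u)"
      by (intro bounded_linearI') (auto simp: vec_eq_iff algebra_simps)
    then show ?thesis
      by (intro borel_measurable_continuous_onI) (simp add: linear_continuous_on)
  qed
  let ?M = "distr lborel borel (\<lambda>u :: complex ^ 'n. c *s u)"
  have c0: "c \<noteq> 0" using c by auto
  have inv: "c *s (inverse c *s v) = v" for v :: "complex ^ 'n"
    using c0 by (simp add: vec_eq_iff)
  have ball: "(\<lambda>u. c *s u) -` ball 0 r = (ball 0 r :: (complex ^ 'n) set)" for r
    using c by (auto simp: norm_vector_smult)
  have "?M = lborel"
  proof (rule translation_invariant_eq_lborel[where B = "ball 0 1"])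
    show "sigma_finite_measure ?M"
    proof
      show "\<exists>A. countable A \<and> A \<subseteq> sets ?M \<and> \<Union>A = space ?M \<and> (\<forall>a\<in>A. emeasure ?M a \<noteq> \<infinity>)"
      proof (intro exI[of _ "range (\<lambda>k. ball 0 (real k))"] conjI ballI)
        show "\<Union> (range (\<lambda>k. ball 0 (real k))) = space ?M"
          by (auto intro: reals_Archimedean2)
        fix a :: "(complex ^ 'n) set" assume "a \<in> range (\<lambda>k. ball 0 (real k))"
        then obtain k where a: "a = ball 0 (real k)" by auto
        show "emeasure ?M a \<noteq> \<infinity>"
          unfolding a using emeasure_bounded_finite[of "ball (0 :: complex ^ 'n) (real k)"]
          by (simp add: emeasure_distr ball less_top)
      qed auto
    qed
    fix y :: "complex ^ 'n" and A :: "(complex ^ 'n) set" assume A[measurable]: "A \<in> sets borel"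
    \<comment> \<open>Translating by y after the rotation amounts to translating by
      \<open>inverse c *s y\<close> before it.\<close>
    have "emeasure lborel {u. c *s u \<in> A} = emeasure (distr lborel borel ((+) (inverse c *s y))) {u. c *s u \<in> A}"
      by (simp add: lborel_distr_plus)
    also have "\<dots> = emeasure lborel {u. c *s u + y \<in> A}"
      by (subst emeasure_distr) (auto simp: vector_add_ldistrib inv c0 vimage_def add_ac)
    finally show "emeasure ?M ((\<lambda>x. x + y) -` A) = emeasure ?M A"
      by (simp add: emeasure_distr vimage_def)
  next
    show "emeasure ?M (ball 0 1) = emeasure lborel (ball (0 :: complex ^ 'n) 1)"
      by (simp add: emeasure_distr ball)
    show "emeasure lborel (ball (0 :: complex ^ 'n) 1) \<noteq> 0"
      using emeasure_dV_unit_ball[where 'n='n] by (auto simp: dV_def)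
    show "emeasure lborel (ball (0 :: complex ^ 'n) 1) < \<infinity>"
      by (rule emeasure_bounded_finite) simp
  qed auto
  then have "(\<integral>\<^sup>+u. f u \<partial>lborel) = (\<integral>\<^sup>+u. f u \<partial>?M)" by simp
  then show ?thesis by (simp add: nn_integral_distr)
qed

subsection \<open>Elementary estimates and norms\<close>

text \<open>Convexity is invoked on the open half-line, where the derivative exists, so x = 0 is
  checked by hand; there the left side is (1 - r) * a powr r.\<close>

lemma powr_above_tangent:
  fixes a x r :: real
  assumes "0 < a" "0 \<le> x" "1 \<le> r"
  shows "a powr r + r * a powr (r - 1) * (x - a) \<le> x powr r"
proof (cases "x = 0")
  case True
  have "a powr r = a powr (r - 1) * a" using assms by (simp add: powr_diff)
  then have "a powr r + r * a powr (r - 1) * (x - a) = (1 - r) * a powr r"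
    using True by (simp add: algebra_simps)
  also have "\<dots> \<le> 0" using assms by (intro mult_nonpos_nonneg) auto
  finally show ?thesis using True by simp
next
  case False
  have d: "((\<lambda>x. x powr r) has_real_derivative r * a powr (r - 1)) (at a within {0<..})"
    using assms by (auto intro!: derivative_eq_intros simp: field_simps powr_diff)
  from convex_on_imp_above_tangent[OF powr_convex[OF assms(3)] _ _ _ d, of x]
  show ?thesis using assms False by (simp add: interior_open)
qed

lemma powr_le_powr_imp_le:
  fixes x y r :: real
  assumes "x powr r \<le> y powr r" "0 \<le> x" "0 \<le> y" "0 < r"
  shows "x \<le> y"
  using assms powr_less_mono2[of r y x] by linarith

lemma powr_square: "(x powr a)\<^sup>2 = x powr (2 * a)" for x a :: real
  by (simp add: power2_eq_square flip: powr_add)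

text \<open>For negative s the two hypotheses exchange roles, hence the absolute value in the
  exponent of A.\<close>

lemma powr_comparable:
  fixes x y A s :: real
  assumes "x \<le> A * y" "y \<le> A * x" "1 \<le> A" "0 < x" "0 < y"
  shows "x powr s \<le> A powr \<bar>s\<bar> * y powr s"
proof (cases "0 \<le> s")
  case True
  then have "x powr s \<le> (A * y) powr s" using assms by (intro powr_mono2) auto
  then show ?thesis using True assms by (simp add: powr_mult)
next
  case False
  then have "y powr (- s) \<le> (A * x) powr (- s)" using assms by (intro powr_mono2) auto
  then have "y powr (- s) \<le> A powr \<bar>s\<bar> * x powr (- s)" using False assms by (simp add: powr_mult)
  then show ?thesis
    using assms by (simp add: powr_minus[of x] powr_minus[of y] field_simps)
qed

text \<open>Peetre's inequality. It moves the polynomial weight to another point at a cost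
  polynomial in the distance, which a Gaussian can absorb.\<close>

lemma one_plus_norm_powr_le:
  fixes z w :: "'a :: real_normed_vector"
  shows "(1 + norm z) powr s \<le> (1 + norm w) powr s * (1 + norm (z - w)) powr \<bar>s\<bar>"
proof -
  have pos: "0 < 1 + norm x" for x :: 'a by (simp add: add_pos_nonneg)
  have *: "1 + norm x \<le> (1 + norm y) * (1 + norm (z - w))" if "x = z \<and> y = w \<or> x = w \<and> y = z" for x y :: 'a
  proof -
    have "norm x \<le> norm y + norm (z - w)"
      using that norm_triangle_sub[of x y] by (auto simp: norm_minus_commute)
    moreover have "0 \<le> norm y * norm (z - w)" by simp
    moreover have "(1 + norm y) * (1 + norm (z - w)) = 1 + norm y + norm (z - w) + norm y * norm (z - w)"
      by (simp add: algebra_simps)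
    ultimately show ?thesis by linarith
  qed
  show ?thesis
  proof (cases "0 \<le> s")
    case True
    then show ?thesis
      using powr_mono2[OF True _ *[of z w]] pos by (simp add: powr_mult less_imp_le)
  next
    case False
    have "(1 + norm w) powr (- s) \<le> (1 + norm z) powr (- s) * (1 + norm (z - w)) powr (- s)"
      using powr_mono2[of "- s", OF _ _ *[of w z]] pos False by (simp add: powr_mult less_imp_le)
    then show ?thesis
      using False pos[of z] pos[of w]
      by (simp add: powr_minus[of "1 + norm z"] powr_minus[of "1 + norm w"] field_simps)
  qed
qed

text \<open>Dyadic decomposition by the size of 1 + norm z: level j lies in the ball of radius
  2^(j+1), so the integral is dominated by a geometric series with ratio 2 powr (2n - s) <
  1.\<close>

lemma nn_integral_one_plus_norm_powr_finite:
  fixes s :: real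
  assumes s: "real (2 * CARD('n)) < s"
  shows "(\<integral>\<^sup>+z. ennreal ((1 + norm z) powr - s) \<partial>(dV :: (complex ^ 'n) measure)) < \<infinity>"
proof -
  let ?d = "2 * CARD('n)"
  let ?g = "\<lambda>j (u :: complex ^ 'n). ennreal (2 powr (- s * real j)) * indicator (ball 0 (2 ^ (j + 1))) u"
  have term_le_suminf: "g k \<le> suminf g" for g :: "nat \<Rightarrow> ennreal" and k
    using sum_le_suminf[of g "{k}"] by simp
  have pointwise: "ennreal ((1 + norm u) powr - s) \<le> (\<Sum>j. ?g j u)" for u :: "complex ^ 'n"
  proof -
    define j where "j = nat \<lfloor>log 2 (1 + norm u)\<rfloor>"
    have "0 \<le> log 2 (1 + norm u)" by (simp add: zero_le_log_cancel_iff add_pos_nonneg)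
    then have j: "real j \<le> log 2 (1 + norm u)" "log 2 (1 + norm u) < real (j + 1)"
      unfolding j_def by linarith+
    then have "2 powr real j \<le> 1 + norm u" "1 + norm u < 2 powr real (j + 1)"
      by (simp_all add: le_log_iff log_less_iff add_pos_nonneg)
    then have l: "2 powr real j \<le> 1 + norm u" "norm u < 2 ^ (j + 1)"
      by (simp_all add: powr_realpow powr_add)
    have "(1 + norm u) powr - s \<le> (2 powr real j) powr - s"
      using s l(1) by (intro powr_mono2') auto
    then have "ennreal ((1 + norm u) powr - s) \<le> ?g j u"
      using l(2) by (simp add: powr_powr mult.commute ennreal_leI)
    also have "\<dots> \<le> (\<Sum>j. ?g j u)" by (rule term_le_suminf)
    finally show ?thesis .
  qed
  define r where "r = 2 powr (real ?d - s)"
  have r: "0 < r" "r < 1" using s powr_less_mono[of "real ?d - s" 0 2] by (auto simp: r_def)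
  have integral_term: "(\<integral>\<^sup>+u. ?g j u \<partial>dV) = ennreal (2 ^ ?d * r ^ j)" for j
  proof -
    have "(\<integral>\<^sup>+u. ?g j u \<partial>dV) = ennreal (2 powr (- s * real j)) * emeasure dV (ball (0 :: complex ^ 'n) (2 ^ (j + 1)))"
      by (subst nn_integral_cmult) auto
    also have "\<dots> = ennreal (2 powr (- s * real j) * (2 ^ (j + 1)) ^ ?d)"
      by (simp add: emeasure_dV_ball ennreal_mult')
    also have "(2 ^ (j + 1)) ^ ?d = (2 :: real) ^ ?d * 2 powr (real ?d * real j)"
      by (simp add: powr_realpow[symmetric] powr_powr powr_add[symmetric] algebra_simps flip: power_mult)
    also have "2 powr (- s * real j) * (2 ^ ?d * 2 powr (real ?d * real j)) = 2 ^ ?d * r ^ j"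
      by (simp add: r_def powr_realpow[symmetric] powr_powr powr_add[symmetric] algebra_simps)
    finally show ?thesis .
  qed
  have "(\<integral>\<^sup>+z. ennreal ((1 + norm z) powr - s) \<partial>(dV :: (complex ^ 'n) measure)) \<le> (\<integral>\<^sup>+u. (\<Sum>j. ?g j u) \<partial>dV)"
    by (intro nn_integral_mono pointwise)
  also have "\<dots> = (\<Sum>j. \<integral>\<^sup>+u. ?g j u \<partial>dV)"
    by (rule nn_integral_suminf) simp
  also have "\<dots> = ennreal (\<Sum>j. 2 ^ ?d * r ^ j)"
    unfolding integral_term using r by (intro suminf_ennreal2) (auto intro!: summable_mult summable_geometric)
  also have "\<dots> < \<infinity>" by simp
  finally show ?thesis by simp
qed

text \<open>Both necessary conditions on the exponents are read off through this growth comparison.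
  It samples only natural J, since J also serves as the size of an exponent box.\<close>

lemma powr_le_imp_exponent_le:
  fixes a b c C :: real
  assumes "0 < c" and le: "\<And>J :: nat. 1 \<le> J \<Longrightarrow> c * real J powr a \<le> C * real J powr b"
  shows "a \<le> b"
proof (rule ccontr)
  assume "\<not> a \<le> b"
  then have "filterlim (\<lambda>J :: nat. real J powr (a - b)) at_top sequentially" by real_asymp
  then have "eventually (\<lambda>J :: nat. C / c < real J powr (a - b) \<and> 1 \<le> J) sequentially"
    by (auto simp: filterlim_at_top_dense intro: eventually_conj eventually_ge_at_top)
  then obtain J :: nat where J: "C / c < real J powr (a - b)" "1 \<le> J"
    by (auto simp: eventually_sequentially)
  have "0 < real J powr b" using J(2) by simp
  then have "C * real J powr b < c * real J powr a"
    using J(1) assms(1) by (simp add: powr_diff field_simps)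
  then show False using le[OF J(2)] by simp
qed

section \<open>The weighted modulus and its norms\<close>

lemma weighted_abs_nonneg [simp]: "0 \<le> weighted_abs l \<alpha> \<rho> f z"
  by (simp add: weighted_abs_def)

lemma borel_measurable_powr_const [measurable]:
  fixes f :: "_ \<Rightarrow> real"
  assumes [measurable]: "f \<in> borel_measurable M"
  shows "(\<lambda>x. f x powr s) \<in> borel_measurable M"
  unfolding powr_def by measurable

lemma weighted_abs_measurable:
  assumes "entire f"
  shows "weighted_abs l \<alpha> \<rho> f \<in> borel_measurable borel"
proof -
  note entire_measurable[OF assms, measurable]
  show ?thesis unfolding weighted_abs_def[abs_def] by measurable
qed

lemma exponent_cases:
  assumes "1 \<le> (p :: ennreal)"
  obtains (top) "p = top" | (real) r where "p = ennreal r" "1 \<le> r"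
proof (cases p)
  case (real r)
  then show ?thesis using assms that(2)[of r] by (simp flip: ennreal_1)
qed (use that in auto)

lemma mem_fock_space_top [simp]:
  "f \<in> fock_space l \<alpha> \<rho> top \<longleftrightarrow> entire f \<and> bdd_above (range (weighted_abs l \<alpha> \<rho> f))"
  by (simp add: fock_space_def)

lemma fock_norm_top [simp]: "fock_norm l \<alpha> \<rho> top f = (SUP z. weighted_abs l \<alpha> \<rho> f z)"
  by (simp add: fock_norm_def)

lemma mem_fock_space_ennreal [simp]:
  "1 \<le> r \<Longrightarrow> f \<in> fock_space l \<alpha> \<rho> (ennreal r) \<longleftrightarrow>
     entire f \<and> (\<integral>\<^sup>+z. ennreal (weighted_abs l \<alpha> \<rho> f z powr r) \<partial>dV) < \<infinity>"
  by (simp add: fock_space_def)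

lemma fock_norm_ennreal:
  "1 \<le> r \<Longrightarrow> fock_norm l \<alpha> \<rho> (ennreal r) f =
     enn2real (\<integral>\<^sup>+z. ennreal (weighted_abs l \<alpha> \<rho> f z powr r) \<partial>dV) powr (1 / r)"
  by (simp add: fock_norm_def)

lemma fock_norm_powr:
  assumes "1 \<le> r" "f \<in> fock_space l \<alpha> \<rho> (ennreal r)"
  shows "ennreal (fock_norm l \<alpha> \<rho> (ennreal r) f powr r) = (\<integral>\<^sup>+z. ennreal (weighted_abs l \<alpha> \<rho> f z powr r) \<partial>dV)"
  using assms by (simp add: fock_norm_ennreal powr_powr)

lemma fock_norm_leI:
  assumes "1 \<le> r" "0 \<le> K" "(\<integral>\<^sup>+z. ennreal (weighted_abs l \<alpha> \<rho> f z powr r) \<partial>dV) \<le> ennreal (K powr r)"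
  shows "fock_norm l \<alpha> \<rho> (ennreal r) f \<le> K"
proof -
  have "enn2real (\<integral>\<^sup>+z. ennreal (weighted_abs l \<alpha> \<rho> f z powr r) \<partial>dV) powr (1 / r) \<le> (K powr r) powr (1 / r)"
    using assms by (intro powr_mono2 enn2real_leI) auto
  then show ?thesis using assms by (simp add: fock_norm_ennreal powr_powr)
qed

lemma fock_norm_top_leI:
  "(\<And>z. weighted_abs l \<alpha> \<rho> f z \<le> K) \<Longrightarrow> fock_norm l \<alpha> \<rho> top f \<le> K"
  by (auto intro: cSUP_least)

text \<open>Membership matters at p = infinity, where the supremum of an unbounded range would be an
  unspecified real.\<close>

lemma fock_norm_nonneg:
  assumes "1 \<le> p" "f \<in> fock_space l \<alpha> \<rho> p"
  shows "0 \<le> fock_norm l \<alpha> \<rho> p f"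
  using assms(1)
proof (cases rule: exponent_cases)
  case top
  then have "weighted_abs l \<alpha> \<rho> f 0 \<le> fock_norm l \<alpha> \<rho> p f"
    using assms(2) by (auto intro!: cSUP_upper)
  then show ?thesis by (rule order_trans[rotated]) simp
qed (simp add: fock_norm_ennreal)

lemma fock_norm_le_of_pointwise_powr:
  assumes "1 \<le> r" "entire f" "0 \<le> K"
    and le: "\<And>z. weighted_abs l \<alpha> \<rho> f z \<le> K * h z"
    and h: "\<And>z. 0 \<le> h z" "h \<in> borel_measurable borel"
    and int: "(\<integral>\<^sup>+z. ennreal (h z powr r) \<partial>dV) \<le> ennreal (I powr r)" "0 \<le> I"
  shows "f \<in> fock_space l \<alpha> \<rho> (ennreal r)" "fock_norm l \<alpha> \<rho> (ennreal r) f \<le> K * I"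
proof -
  note h(2)[measurable]
  have "(\<integral>\<^sup>+z. ennreal (weighted_abs l \<alpha> \<rho> f z powr r) \<partial>dV) \<le> (\<integral>\<^sup>+z. ennreal (K powr r) * ennreal (h z powr r) \<partial>dV)"
  proof (intro nn_integral_mono)
    fix z
    have "weighted_abs l \<alpha> \<rho> f z powr r \<le> (K * h z) powr r"
      using assms by (intro powr_mono2) auto
    then show "ennreal (weighted_abs l \<alpha> \<rho> f z powr r) \<le> ennreal (K powr r) * ennreal (h z powr r)"
      using h assms by (simp add: powr_mult ennreal_leI flip: ennreal_mult')
  qed
  also have "\<dots> = ennreal (K powr r) * (\<integral>\<^sup>+z. ennreal (h z powr r) \<partial>dV)"
    by (rule nn_integral_cmult) simp
  also have "\<dots> \<le> ennreal (K powr r) * ennreal (I powr r)"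
    using int by (intro mult_left_mono) auto
  also have "\<dots> = ennreal ((K * I) powr r)"
    using assms by (simp add: powr_mult flip: ennreal_mult')
  finally have *: "(\<integral>\<^sup>+z. ennreal (weighted_abs l \<alpha> \<rho> f z powr r) \<partial>dV) \<le> ennreal ((K * I) powr r)" .
  then show "f \<in> fock_space l \<alpha> \<rho> (ennreal r)"
    using assms by (auto intro: le_less_trans)
  show "fock_norm l \<alpha> \<rho> (ennreal r) f \<le> K * I"
    using * assms by (intro fock_norm_leI) auto
qed

subsection \<open>Pointwise bounds and the classical embedding\<close>

text \<open>Cauchy's formula at the centre: along the unit circle the kernel 1/u cancels against the
  derivative of the path, up to the constant 2 pi i.\<close>

lemma holomorphic_circle_mean:
  assumes "F holomorphic_on UNIV"
  shows "((\<lambda>t. F (cis (2 * pi * t))) has_integral F 0) {0..1}"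
proof -
  have "((\<lambda>u. F u / (u - 0)) has_contour_integral (2 * of_real pi * \<i> * F 0)) (circlepath 0 1)"
    by (rule Cauchy_integral_circlepath_simple) (use assms in \<open>auto intro: holomorphic_on_subset\<close>)
  then have "((\<lambda>t. 2 * of_real pi * \<i> * F (cis (2 * pi * t))) has_integral (2 * of_real pi * \<i> * F 0)) {0..1}"
    unfolding has_contour_integral vector_derivative_circlepath
    by (simp add: circlepath cis_conv_exp mult_ac)
  then have "((\<lambda>t. inverse (2 * of_real pi * \<i>) * (2 * of_real pi * \<i> * F (cis (2 * pi * t)))) has_integral
      inverse (2 * of_real pi * \<i>) * (2 * of_real pi * \<i> * F 0)) {0..1}"
    by (rule has_integral_mult_right)
  moreover have "inverse (2 * of_real pi * \<i>) * (2 * of_real pi * \<i> * x) = x" for x :: complex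
    by (subst mult.assoc[symmetric], subst left_inverse) auto
  ultimately show ?thesis by (simp only:)
qed

text \<open>Jensen's inequality, obtained by integrating the tangent line of \<open>x \<mapsto> x powr r\<close> at
  \<open>norm (F 0)\<close>.\<close>

lemma holomorphic_circle_mean_powr:
  assumes F: "F holomorphic_on UNIV" and r: "1 \<le> r"
  shows "ennreal (norm (F 0) powr r) \<le> (\<integral>\<^sup>+t. ennreal (norm (F (cis (2 * pi * t))) powr r) * indicator {0..1} t \<partial>lborel)"
proof -
  let ?a = "norm (F 0)" and ?h = "\<lambda>t. F (cis (2 * pi * t))"
  have contF: "continuous_on A F" for A
    using F holomorphic_on_imp_continuous_on continuous_on_subset by blast
  have cont: "continuous_on {0..1} ?h"
    by (rule continuous_on_compose2[OF contF[of UNIV]]) (auto intro!: continuous_intros)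
  \<comment> \<open>The tangent line needs a positive base point; if F vanishes at 0, the claim is
    trivial.\<close>
  have "?a powr r \<le> integral {0..1} (\<lambda>t. norm (?h t) powr r)" if "?a > 0"
  proof -
    let ?l = "\<lambda>x. ?a powr r + r * ?a powr (r - 1) * (x - ?a)"
    have int: "(\<lambda>t. norm (?h t)) integrable_on {0..1}" "(\<lambda>t. norm (?h t) powr r) integrable_on {0..1}"
      using r by (auto intro!: integrable_continuous_interval continuous_intros cont continuous_on_powr')
    have "?a \<le> integral {0..1} (\<lambda>t. norm (?h t))"
      using holomorphic_circle_mean[OF F] int(1)
      by (metis has_integral_integrable has_integral_iff integral_norm_bound_integral order_refl)
    then have "?a powr r \<le> ?l (integral {0..1} (\<lambda>t. norm (?h t)))"
      using that r by simp
    also have "\<dots> \<le> integral {0..1} (\<lambda>t. norm (?h t) powr r)"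
    proof (rule has_integral_le)
      show "((\<lambda>t. ?l (norm (?h t))) has_integral ?l (integral {0..1} (\<lambda>t. norm (?h t)))) {0..1}"
        using has_integral_add[OF has_integral_const_real[of "?a powr r" 0 1]
            has_integral_mult_right[OF has_integral_diff[OF integrable_integral[OF int(1)] has_integral_const_real[of ?a 0 1]]]]
        by simp
      show "((\<lambda>t. norm (?h t) powr r) has_integral integral {0..1} (\<lambda>t. norm (?h t) powr r)) {0..1}"
        by (rule integrable_integral[OF int(2)])
    qed (use that r powr_above_tangent in auto)
    finally show ?thesis .
  qed
  moreover have "((\<lambda>t. norm (?h t) powr r) has_integral integral {0..1} (\<lambda>t. norm (?h t) powr r)) {0..1}"
    using r by (intro integrable_integral integrable_continuous_interval continuous_on_powr' continuous_intros cont) auto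
  from nn_integral_has_integral_lebesgue'[OF _ this] have
    "(\<integral>\<^sup>+t. ennreal (norm (?h t) powr r) * indicator {0..1} t \<partial>lborel) = ennreal (integral {0..1} (\<lambda>t. norm (?h t) powr r))"
    by simp
  ultimately show ?thesis by (cases "?a > 0") (auto intro: ennreal_leI)
qed

text \<open>Every u in the unit ball spans a circle \<open>w + cis (2 * pi * t) *s u\<close> on
  which the one-variable inequality holds. Integrating it over u and exchanging the integrals,
  rotation invariance makes the inner integral independent of t, so polar coordinates are
  avoided.\<close>

lemma entire_ball_mean_powr:
  fixes w :: "complex ^ 'n"
  assumes g: "entire g" and r: "1 \<le> r"
  shows "ennreal (norm (g w) powr r) \<le> (\<integral>\<^sup>+z. ennreal (norm (g z) powr r) * indicator (ball w 1) z \<partial>dV)"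
proof -
  let ?B = "ball (0 :: complex ^ 'n) 1"
  let ?h = "\<lambda>u. ennreal (norm (g (w + u)) powr r) * indicator ?B u"
  let ?c = "\<lambda>t. cis (2 * pi * t)"
  note entire_measurable[OF g, measurable]
  have cont: "continuous_on UNIV (\<lambda>x :: real \<times> (complex ^ 'n). ?c (fst x) *s snd x)"
    unfolding vector_scalar_mult_def by (intro continuous_intros continuous_on_vec_lambda)
  note borel_measurable_continuous_onI[OF this, unfolded borel_prod[symmetric], measurable]
  have ind: "indicator ?B (?c t *s u) = (indicator ?B u :: ennreal)" for t u
    by (simp add: indicator_def norm_vector_smult)
  have "ennreal (norm (g w) powr r) * emeasure lborel ?B
      = (\<integral>\<^sup>+u. ennreal (norm (g w) powr r) * indicator ?B u \<partial>lborel)"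
    by (rule nn_integral_cmult_indicator[symmetric]) simp
  also have "\<dots> \<le> (\<integral>\<^sup>+u. (\<integral>\<^sup>+t. ?h (?c t *s u) * indicator {0..1} t \<partial>lborel) \<partial>lborel)"
  proof (intro nn_integral_mono)
    fix u
    have "ennreal (norm (g (w + 0 *s u)) powr r) \<le>
        (\<integral>\<^sup>+t. ennreal (norm (g (w + ?c t *s u)) powr r) * indicator {0..1} t \<partial>lborel)"
      by (rule holomorphic_circle_mean_powr[OF entire_on_line[OF g] r])
    then show "ennreal (norm (g w) powr r) * indicator ?B u \<le> (\<integral>\<^sup>+t. ?h (?c t *s u) * indicator {0..1} t \<partial>lborel)"
      unfolding ind by (cases "u \<in> ?B") auto
  qed
  also have "\<dots> = (\<integral>\<^sup>+t. (\<integral>\<^sup>+u. ?h (?c t *s u) * indicator {0..1} t \<partial>lborel) \<partial>lborel)"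
    unfolding ind by (rule lborel_pair.Fubini') measurable
  also have "\<dots> = (\<integral>\<^sup>+t. (\<integral>\<^sup>+u. ?h u \<partial>lborel) * indicator {0..1 :: real} t \<partial>lborel)"
  proof (rule nn_integral_cong)
    fix t :: real
    have "(\<integral>\<^sup>+u. ?h (?c t *s u) \<partial>lborel) = (\<integral>\<^sup>+u. ?h u \<partial>lborel)"
      by (rule nn_integral_lborel_rotate) simp_all
    then show "(\<integral>\<^sup>+u. ?h (?c t *s u) * indicator {0..1} t \<partial>lborel) = (\<integral>\<^sup>+u. ?h u \<partial>lborel) * indicator {0..1} t"
      by (cases "t \<in> {0..1}") auto
  qed
  also have "\<dots> = (\<integral>\<^sup>+u. ?h u \<partial>lborel)"
    by (simp add: nn_integral_cmult)
  finally have le: "ennreal (norm (g w) powr r) * emeasure lborel ?B \<le> (\<integral>\<^sup>+u. ?h u \<partial>lborel)" .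
  have "(\<integral>\<^sup>+z. ennreal (norm (g z) powr r) * indicator (ball w 1) z \<partial>dV)
      = (\<integral>\<^sup>+z. ?h (1 *\<^sub>R (z - w)) \<partial>dV)"
    by (intro nn_integral_cong) (auto simp: indicator_def dist_norm norm_minus_commute)
  also have "\<dots> = (\<integral>\<^sup>+z. ?h z \<partial>dV)"
    by (subst nn_integral_dV_affine) simp_all
  also have "\<dots> = 1 / emeasure lborel ?B * (\<integral>\<^sup>+u. ?h u \<partial>lborel)"
    by (rule nn_integral_dV) simp
  also have "\<dots> \<ge> 1 / emeasure lborel ?B * (ennreal (norm (g w) powr r) * emeasure lborel ?B)"
    using le by (rule mult_left_mono) simp
  also have "1 / emeasure lborel ?B * (ennreal (norm (g w) powr r) * emeasure lborel ?B) = ennreal (norm (g w) powr r)"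
    using emeasure_dV_unit_ball[where 'n='n] unfolding dV_def emeasure_scale_measure
    by (metis mult.commute mult.left_commute mult.right_neutral)
  finally show ?thesis .
qed

text \<open>The function \<open>z \<mapsto> f z * exp (- \<beta> * \<langle>z, w\<rangle>)\<close> turns the weight at \<open>z\<close> into a
  function of \<open>z - w\<close>.\<close>

lemma weighted_abs_pointwise_bound:
  fixes f :: "complex ^ 'n \<Rightarrow> complex" and w :: "complex ^ 'n"
  assumes f: "entire f" and r: "1 \<le> r" and \<beta>: "0 < \<beta>"
  shows "ennreal (weighted_abs 1 \<beta> \<rho> f w powr r) \<le>
    ennreal ((exp (\<beta> / 2) * 2 powr \<bar>\<rho>\<bar>) powr r) * (\<integral>\<^sup>+z. ennreal (weighted_abs 1 \<beta> \<rho> f z powr r) \<partial>dV)"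
proof -
  let ?T = "weighted_abs 1 \<beta> \<rho> f" and ?K = "exp (\<beta> / 2) * 2 powr \<bar>\<rho>\<bar>"
  note weighted_abs_measurable[OF f, measurable]
  define g where "g z = f z * exp (- of_real \<beta> * (\<Sum>i\<in>UNIV. z $ i * cnj (w $ i)))" for z
  have g: "entire g"
    unfolding g_def by (intro entire_mult f entire_exp entire_const entire_sum entire_nth)
  note entire_measurable[OF g, measurable]
  have ng: "norm (g z) = norm (f z) * exp (- \<beta> * (z \<bullet> w))" for z
    by (simp add: g_def norm_mult inner_vec_def inner_complex_def)
  \<comment> \<open>Completing the square: -\<beta> (z . w) + (\<beta>/2) |w|^2 = (\<beta>/2) |z -
    w|^2 - (\<beta>/2) |z|^2. So multiplying |g| by c restores the weight exactly at w, and up to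
    the factor exp (\<beta>/2) on the unit ball around w.\<close>
  define c where "c = exp (\<beta> / 2 * (norm w)\<^sup>2) * (1 + norm w) powr \<rho>"
  have c: "0 \<le> c" by (simp add: c_def)
  have sq: "norm x powr 2 = (norm x)\<^sup>2" for x :: "complex ^ 'n"
    by (cases "x = 0") simp_all
  have gw: "norm (g w) * c = ?T w"
    by (simp add: ng c_def weighted_abs_def sq dot_square_norm flip: exp_add)
  have gz: "norm (g z) * c \<le> ?K * ?T z" if "z \<in> ball w 1" for z
  proof -
    have d: "norm (z - w) < 1" using that by (simp add: dist_norm norm_minus_commute)
    have "(1 + norm w) powr \<rho> \<le> (1 + norm z) powr \<rho> * (1 + norm (z - w)) powr \<bar>\<rho>\<bar>"
      using one_plus_norm_powr_le[of w \<rho> z] by (simp add: norm_minus_commute)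
    also have "\<dots> \<le> (1 + norm z) powr \<rho> * 2 powr \<bar>\<rho>\<bar>"
      using d by (intro mult_left_mono powr_mono2) auto
    finally have 1: "(1 + norm w) powr \<rho> \<le> (1 + norm z) powr \<rho> * 2 powr \<bar>\<rho>\<bar>" .
    have "(norm (z - w))\<^sup>2 = (norm z)\<^sup>2 - 2 * (z \<bullet> w) + (norm w)\<^sup>2"
      by (simp add: power2_norm_eq_inner inner_diff inner_commute)
    moreover have "(norm (z - w))\<^sup>2 \<le> 1" using d by (simp add: power_le_one)
    ultimately have "\<beta> * ((norm z)\<^sup>2 - 2 * (z \<bullet> w) + (norm w)\<^sup>2) \<le> \<beta> * 1"
      using \<beta> by (intro mult_left_mono) auto
    then have 2: "exp (- \<beta> * (z \<bullet> w)) * exp (\<beta> / 2 * (norm w)\<^sup>2) \<le> exp (\<beta> / 2) * exp (- (\<beta> / 2) * (norm z)\<^sup>2)"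
      by (simp add: algebra_simps flip: exp_add)
    have "norm (g z) * c = norm (f z) * ((exp (- \<beta> * (z \<bullet> w)) * exp (\<beta> / 2 * (norm w)\<^sup>2)) * (1 + norm w) powr \<rho>)"
      by (simp add: ng c_def mult_ac)
    also have "\<dots> \<le> norm (f z) * ((exp (\<beta> / 2) * exp (- (\<beta> / 2) * (norm z)\<^sup>2)) * ((1 + norm z) powr \<rho> * 2 powr \<bar>\<rho>\<bar>))"
      by (intro mult_left_mono mult_mono 1 2) auto
    also have "\<dots> = ?K * ?T z"
      by (simp add: weighted_abs_def sq mult_ac)
    finally show ?thesis .
  qed
  have "ennreal (?T w powr r) = ennreal (norm (g w) powr r) * ennreal (c powr r)"
    using c by (simp add: powr_mult flip: gw ennreal_mult')
  also have "\<dots> \<le> (\<integral>\<^sup>+z. ennreal (norm (g z) powr r) * indicator (ball w 1) z \<partial>dV) * ennreal (c powr r)"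
    by (intro mult_right_mono entire_ball_mean_powr g r) simp
  also have "\<dots> = (\<integral>\<^sup>+z. ennreal (norm (g z) powr r) * indicator (ball w 1) z * ennreal (c powr r) \<partial>dV)"
    by (rule nn_integral_multc[symmetric]) simp
  also have "\<dots> \<le> (\<integral>\<^sup>+z. ennreal (?K powr r) * ennreal (?T z powr r) \<partial>dV)"
  proof (intro nn_integral_mono)
    fix z
    show "ennreal (norm (g z) powr r) * indicator (ball w 1) z * ennreal (c powr r) \<le> ennreal (?K powr r) * ennreal (?T z powr r)"
    proof (cases "z \<in> ball w 1")
      case True
      have "(norm (g z) * c) powr r \<le> (?K * ?T z) powr r"
        using r c gz[OF True] by (intro powr_mono2) auto
      then show ?thesis
        using True c by (simp add: powr_mult ennreal_leI flip: ennreal_mult')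
    qed simp
  qed
  also have "\<dots> = ennreal (?K powr r) * (\<integral>\<^sup>+z. ennreal (?T z powr r) \<partial>dV)"
    by (rule nn_integral_cmult) simp
  finally show ?thesis .
qed

lemma fock_embeds_refl: "fock_embeds TYPE('n::finite) l \<beta> \<rho> p \<rho> p"
  by (auto simp: fock_embeds_def embeds_def intro: exI[of _ 1])

lemma fock_embeds_classical:
  assumes \<beta>: "0 < \<beta>" and p: "1 \<le> p" and pq: "p \<le> q"
  shows "fock_embeds TYPE('n::finite) 1 \<beta> \<rho> p \<rho> q"
  using p
proof (cases rule: exponent_cases)
  case top
  then show ?thesis using pq by (simp add: top_unique fock_embeds_refl)
next
  case (real r)
  let ?K = "exp (\<beta> / 2) * 2 powr \<bar>\<rho>\<bar>"
  have sup: "weighted_abs 1 \<beta> \<rho> f w \<le> ?K * fock_norm 1 \<beta> \<rho> p f" if f: "f \<in> fock_space 1 \<beta> \<rho> p"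
    for f :: "complex ^ 'n \<Rightarrow> complex" and w
  proof -
    have nonneg: "0 \<le> fock_norm 1 \<beta> \<rho> p f" using p f by (rule fock_norm_nonneg)
    have "ennreal (weighted_abs 1 \<beta> \<rho> f w powr r) \<le> ennreal (?K powr r) * ennreal (fock_norm 1 \<beta> \<rho> p f powr r)"
      using f real fock_norm_powr[of r f 1 \<beta> \<rho>] weighted_abs_pointwise_bound[of f r \<beta> \<rho> w] \<beta> by simp
    then have "weighted_abs 1 \<beta> \<rho> f w powr r \<le> (?K * fock_norm 1 \<beta> \<rho> p f) powr r"
      using nonneg by (simp add: powr_mult flip: ennreal_mult')
    then show ?thesis by (rule powr_le_powr_imp_le) (use nonneg real(2) in auto)
  qed
  have "1 \<le> q" using p pq by (rule order_trans)
  then show ?thesis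
  proof (cases rule: exponent_cases)
    case top
    have "f \<in> fock_space 1 \<beta> \<rho> q \<and> fock_norm 1 \<beta> \<rho> q f \<le> ?K * fock_norm 1 \<beta> \<rho> p f"
      if f: "f \<in> fock_space 1 \<beta> \<rho> p" for f :: "complex ^ 'n \<Rightarrow> complex"
    proof
      show "fock_norm 1 \<beta> \<rho> q f \<le> ?K * fock_norm 1 \<beta> \<rho> p f"
        unfolding top by (rule fock_norm_top_leI[OF sup[OF f]])
      show "f \<in> fock_space 1 \<beta> \<rho> q"
        unfolding top using f sup[OF f] by (auto intro!: bdd_aboveI2) (simp add: fock_space_def)
    qed
    then show ?thesis unfolding fock_embeds_def embeds_def by blast
  next
    case (real s)
    have rs: "r \<le> s" using pq real \<open>p = ennreal r\<close> \<open>1 \<le> r\<close> by (simp add: ennreal_le_iff)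
    \<comment> \<open>The constant is the s-th root of \<open>?K powr (s - r)\<close>, from bounding
      s - r of the s factors of T pointwise and integrating the other r.\<close>
    have "f \<in> fock_space 1 \<beta> \<rho> q \<and> fock_norm 1 \<beta> \<rho> q f \<le> ?K powr (1 - r / s) * fock_norm 1 \<beta> \<rho> p f"
      if f: "f \<in> fock_space 1 \<beta> \<rho> p" for f :: "complex ^ 'n \<Rightarrow> complex"
    proof -
      let ?T = "weighted_abs 1 \<beta> \<rho> f" and ?N = "fock_norm 1 \<beta> \<rho> p f"
      have f': "entire f" using f by (simp add: fock_space_def)
      note weighted_abs_measurable[OF f', measurable]
      have nonneg: "0 \<le> ?N" using p f by (rule fock_norm_nonneg)
      have "(\<integral>\<^sup>+z. ennreal (?T z powr s) \<partial>dV) \<le> (\<integral>\<^sup>+z. ennreal ((?K * ?N) powr (s - r)) * ennreal (?T z powr r) \<partial>dV)"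
      proof (intro nn_integral_mono)
        fix z
        have "?T z powr s = ?T z powr (s - r) * ?T z powr r"
          by (simp flip: powr_add)
        also have "\<dots> \<le> (?K * ?N) powr (s - r) * ?T z powr r"
          using rs sup[OF f] by (intro mult_right_mono powr_mono2) auto
        finally show "ennreal (?T z powr s) \<le> ennreal ((?K * ?N) powr (s - r)) * ennreal (?T z powr r)"
          by (simp add: ennreal_leI flip: ennreal_mult')
      qed
      also have "\<dots> = ennreal ((?K * ?N) powr (s - r)) * (\<integral>\<^sup>+z. ennreal (?T z powr r) \<partial>dV)"
        by (rule nn_integral_cmult) simp
      also have "\<dots> = ennreal ((?K * ?N) powr (s - r)) * ennreal (?N powr r)"
        using f \<open>p = ennreal r\<close> \<open>1 \<le> r\<close> by (subst fock_norm_powr[symmetric]) auto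
      also have "\<dots> = ennreal ((?K powr (1 - r / s) * ?N) powr s)"
        using nonneg real(2) by (simp add: powr_mult powr_powr algebra_simps flip: ennreal_mult' powr_add)
      finally have le: "(\<integral>\<^sup>+z. ennreal (?T z powr s) \<partial>dV) \<le> ennreal ((?K powr (1 - r / s) * ?N) powr s)" .
      then show ?thesis
        using f' nonneg real by (auto intro!: fock_norm_leI intro: le_less_trans)
    qed
    then show ?thesis unfolding fock_embeds_def embeds_def by blast
  qed
qed

subsection \<open>Peak functions\<close>

text \<open>The tangent at y, evaluated at 1, reduces the gap to l times the product of
  \<open>y powr (l - 1) - 1\<close> and \<open>y - 1\<close>; each factor is linear in y - 1, which
  makes the bound quadratic.\<close>

lemma powr_tangent_upper:
  fixes y l :: real
  assumes "0 < y" "y \<le> 3" "1 \<le> l"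
  shows "y powr l - 1 - l * (y - 1) \<le> l\<^sup>2 * 3 powr l * (y - 1)\<^sup>2"
proof -
  have y: "y powr l = y powr (l - 1) * y" using assms by (simp add: powr_diff)
  have "y powr l + l * y powr (l - 1) * (1 - y) \<le> 1"
    using powr_above_tangent[of y 1 l] assms by simp
  then have 1: "y powr l - 1 - l * (y - 1) \<le> l * ((y powr (l - 1) - 1) * (y - 1))"
    by (simp add: algebra_simps)
  have "(y powr (l - 1) - 1) * (y - 1) \<le> l * 3 powr l * (y - 1)\<^sup>2"
  proof (cases "1 \<le> y")
    case True
    \<comment> \<open>The exponent l - 1 may be below 1, where \<open>powr\<close> is not convex, so
      the power is first compared with \<open>y powr l\<close>.\<close>
    have "y powr (l - 1) \<le> y powr l" using True by (intro powr_mono) auto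
    also have "y powr l - 1 \<le> l * y powr (l - 1) * (y - 1)"
      using powr_above_tangent[of y 1 l] assms by (simp add: algebra_simps)
    also have "y powr (l - 1) \<le> 3 powr l"
      using powr_mono2[of "l - 1" y 3] powr_mono[of "l - 1" l 3] assms by linarith
    finally have "y powr (l - 1) - 1 \<le> l * 3 powr l * (y - 1)"
      using True assms by (simp add: mult_left_mono mult_right_mono)
    then have "(y powr (l - 1) - 1) * (y - 1) \<le> (l * 3 powr l * (y - 1)) * (y - 1)"
      using True by (intro mult_right_mono) auto
    then show ?thesis by (simp add: power2_eq_square mult.assoc)
  next
    case False
    have "y powr l \<le> y powr (l - 1)" using False assms by (intro powr_mono') auto
    then have "1 - y powr (l - 1) \<le> l * (1 - y)"
      using powr_above_tangent[of 1 y l] assms by (simp add: algebra_simps)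
    also have "\<dots> \<le> l * 3 powr l * (1 - y)"
      using False assms by (intro mult_right_mono) (auto simp: ge_one_powr_ge_zero)
    finally have "(1 - y powr (l - 1)) * (1 - y) \<le> (l * 3 powr l * (1 - y)) * (1 - y)"
      using False by (intro mult_right_mono) auto
    then show ?thesis by (simp add: power2_eq_square algebra_simps)
  qed
  then have "l * ((y powr (l - 1) - 1) * (y - 1)) \<le> l * (l * 3 powr l * (y - 1)\<^sup>2)"
    using assms by (intro mult_left_mono) auto
  with 1 show ?thesis by (simp add: power2_eq_square mult.assoc)
qed

lemma gaussian_times_powr_bounded:
  fixes c M :: real
  assumes "0 < c"
  obtains C where "0 < C" "\<And>t. 0 \<le> t \<Longrightarrow> (1 + t) powr M * exp (- c * t\<^sup>2) \<le> C"
proof -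
  let ?f = "\<lambda>t :: real. (1 + t) powr M * exp (- c * t\<^sup>2)"
  have "(?f \<longlongrightarrow> 0) at_top" using assms by real_asymp
  then have "eventually (\<lambda>t. ?f t < 1) at_top"
    by (rule order_tendstoD) simp
  then obtain T where T: "\<And>t. T \<le> t \<Longrightarrow> ?f t < 1" by (auto simp: eventually_at_top_linorder)
  have "compact (?f ` {0..T})"
    by (intro compact_continuous_image compact_Icc continuous_intros) auto
  then have "bounded (?f ` {0..T})" by (rule compact_imp_bounded)
  then obtain B where B: "\<And>t. t \<in> {0..T} \<Longrightarrow> norm (?f t) \<le> B"
    unfolding bounded_iff by blast
  show ?thesis
  proof (rule that[of "max 1 B"])
    fix t :: real assume "0 \<le> t"
    then show "?f t \<le> max 1 B"
      using T[of t] B[of t] by (cases "T \<le> t") auto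
  qed simp
qed

lemma norm_axis_complex [simp]: "norm (axis i x :: complex ^ 'n) = norm x"
proof -
  have "(\<Sum>j\<in>UNIV. (norm ((axis i x :: complex ^ 'n) $ j))\<^sup>2) = (\<Sum>j\<in>UNIV. if j = i then (norm x)\<^sup>2 else 0)"
    by (intro sum.cong) (auto simp: axis_def)
  then show ?thesis by (simp add: norm_vec_def L2_set_def)
qed

text \<open>The exponential of the linear part of the weight at the point \<open>axis i R\<close>; its weighted
  modulus is the exponential of minus a Bregman divergence of the weight, hence concentrated on a
  ball of radius \<open>R powr (1 - l)\<close> around that point.\<close>

definition peak :: "real \<Rightarrow> real \<Rightarrow> 'n::finite \<Rightarrow> real \<Rightarrow> complex ^ 'n \<Rightarrow> complex" where
  "peak l \<beta> i R z =
     exp (of_real (\<beta> * l * R powr (2 * l - 1)) * z $ i - of_real (\<beta> / 2 * (2 * l - 1) * R powr (2 * l)))"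

definition peak_div :: "real \<Rightarrow> 'n::finite \<Rightarrow> real \<Rightarrow> complex ^ 'n \<Rightarrow> real" where
  "peak_div l i R z = norm z powr (2 * l) - R powr (2 * l) - 2 * l * R powr (2 * l - 1) * (Re (z $ i) - R)"

lemma entire_peak: "entire (peak l \<beta> i R)"
proof -
  have "entire (\<lambda>z. exp (of_real (\<beta> * l * R powr (2 * l - 1)) * z $ i + - of_real (\<beta> / 2 * (2 * l - 1) * R powr (2 * l))))"
    by (intro entire_exp entire_add entire_mult entire_nth entire_const)
  then show ?thesis by (simp add: peak_def[abs_def])
qed

text \<open>The constant subtracted in \<open>peak\<close> makes the exponent vanish at the centre,
  so only the polynomial weight remains there.\<close>

lemma weighted_abs_peak:
  assumes "0 < R"
  shows "weighted_abs l \<beta> \<rho> (peak l \<beta> i R) z = (1 + norm z) powr \<rho> * exp (- (\<beta> / 2) * peak_div l i R z)"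
proof -
  have "norm (peak l \<beta> i R z) * exp (- (\<beta> / 2) * norm z powr (2 * l)) = exp (- (\<beta> / 2) * peak_div l i R z)"
    using assms
    by (simp add: peak_def peak_div_def flip: exp_add)
       (simp add: powr_diff field_simps)
  then show ?thesis by (simp add: weighted_abs_def mult_ac)
qed

text \<open>The weight is the convex function \<open>y powr l\<close> of the squared norm. The first
  summand is its gap above the tangent in y; the linear term in y differs from the real-linear
  tangent in z by an exact square, the second summand. Both bounds on \<open>peak_div\<close> are
  then termwise, and the square shows the radius \<open>R powr (1 - l)\<close>.\<close>

lemma peak_div_eq:
  assumes R: "0 < R"
  shows "peak_div l i R z = R powr (2 * l) * (((norm z / R)\<^sup>2) powr l - 1 - l * ((norm z / R)\<^sup>2 - 1))
    + l * (R powr (l - 1) * norm (z - axis i (of_real R)))\<^sup>2"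
proof -
  have sq: "(x\<^sup>2) powr a = x powr (2 * a)" if "0 \<le> x" for x a :: real
    using that by (cases "x = 0") (simp_all add: powr_powr flip: powr_numeral)
  have n: "(norm (z - axis i (of_real R)))\<^sup>2 = (norm z)\<^sup>2 - 2 * R * Re (z $ i) + R\<^sup>2"
    by (simp add: power2_norm_eq_inner inner_diff inner_axis inner_commute inner_complex_def)
       (simp add: inner_commute[of "axis i _"] inner_axis inner_complex_def power2_eq_square)
  have p: "R powr (2 * l) = (R powr (l - 1))\<^sup>2 * R\<^sup>2" "R powr (2 * l - 1) = (R powr (l - 1))\<^sup>2 * R"
  proof -
    have "R powr (2 * l) = R powr (l - 1) * R powr (l - 1) * R powr 2"
      by (simp flip: powr_add)
    then show "R powr (2 * l) = (R powr (l - 1))\<^sup>2 * R\<^sup>2"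
      using R by (simp add: power2_eq_square)
    have "R powr (2 * l - 1) = R powr ((l - 1) + (l - 1) + 1)" by simp
    also have "\<dots> = R powr (l - 1) * R powr (l - 1) * R powr 1" by (simp only: powr_add)
    finally show "R powr (2 * l - 1) = (R powr (l - 1))\<^sup>2 * R"
      using R by (simp add: power2_eq_square)
  qed
  have y: "R powr (2 * l) * ((norm z / R)\<^sup>2) powr l = norm z powr (2 * l)"
    using R by (subst sq) (auto simp: powr_divide)
  have "R powr (2 * l) * (l * ((norm z / R)\<^sup>2 - 1)) = l * (R powr (l - 1))\<^sup>2 * ((norm z)\<^sup>2 - R\<^sup>2)"
    unfolding p(1) using R by (simp add: field_simps)
  then show ?thesis
    unfolding right_diff_distrib[of "R powr (2 * l)"] y peak_div_def power_mult_distrib n p(2)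
    by (simp add: algebra_simps power2_eq_square)
qed

lemma peak_div_ge:
  assumes "0 < R" "1 \<le> l"
  shows "l * (R powr (l - 1) * norm (z - axis i (of_real R)))\<^sup>2 \<le> peak_div l i R z"
proof -
  have "0 \<le> ((norm z / R)\<^sup>2) powr l - 1 - l * ((norm z / R)\<^sup>2 - 1)"
    using powr_above_tangent[of 1 "(norm z / R)\<^sup>2" l] assms by simp
  then show ?thesis using assms by (subst peak_div_eq) (auto simp: zero_le_mult_iff)
qed

lemma peak_div_le:
  assumes R: "1 \<le> R" and l: "1 \<le> l" and z: "R powr (l - 1) * norm (z - axis i (of_real R)) \<le> 1 / 2"
  shows "peak_div l i R z \<le> 9 * (l\<^sup>2 * 3 powr l) + l"
proof -
  let ?d = "norm (z - axis i (of_real R))" and ?y = "(norm z / R)\<^sup>2"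
  have R1: "1 \<le> R powr (l - 1)" using R l by (simp add: ge_one_powr_ge_zero)
  have "?d \<le> R powr (l - 1) * ?d" using mult_right_mono[OF R1, of ?d] by simp
  then have d: "?d \<le> 1 / 2" using z by linarith
  have tri: "\<bar>norm z - R\<bar> \<le> ?d"
    using norm_triangle_ineq3[of z "axis i (of_real R)"] R by simp
  have zR: "norm z / R \<le> 3 / 2" "0 < norm z / R" using tri d R by (auto simp: field_simps)
  then have z3: "norm z / R + 1 \<le> 3" by linarith
  have "?y \<le> (3 / 2)\<^sup>2" using zR by (intro power_mono) auto
  also have "(3 / 2)\<^sup>2 \<le> (3 :: real)" by (simp add: power2_eq_square)
  finally have y: "0 < ?y" "?y \<le> 3" using zR(2) by (auto intro: zero_less_power)
  \<comment> \<open>This factorisation gives R * |y - 1| \<le> 3 * norm (z - centre), hence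
    \<open>R powr l * \<bar>?y - 1\<bar>\<close> is at most 3; its square is the 9 in the
    claim.\<close>
  have "?y - 1 = (norm z - R) / R * (norm z / R + 1)"
    using R by (simp add: field_simps power2_eq_square)
  then have "\<bar>?y - 1\<bar> = \<bar>norm z - R\<bar> / R * (norm z / R + 1)"
    using R zR(2) by (simp only: abs_mult abs_divide)
  also have "\<dots> \<le> ?d / R * 3"
    using tri zR(2) R z3 by (intro mult_mono divide_right_mono) auto
  finally have "R * \<bar>?y - 1\<bar> \<le> R * (?d / R * 3)" using R by (intro mult_left_mono) auto
  then have "R * \<bar>?y - 1\<bar> \<le> 3 * ?d" using R by simp
  then have "R powr (l - 1) * (R * \<bar>?y - 1\<bar>) \<le> R powr (l - 1) * (3 * ?d)"
    by (rule mult_left_mono) simp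
  also have "\<dots> \<le> 3" using z by simp
  also have "R powr (l - 1) * (R * \<bar>?y - 1\<bar>) = R powr l * \<bar>?y - 1\<bar>" using R by (simp add: powr_diff)
  finally have "(R powr l * \<bar>?y - 1\<bar>)\<^sup>2 \<le> 3\<^sup>2" by (intro power_mono) auto
  then have y2: "R powr (2 * l) * (?y - 1)\<^sup>2 \<le> 9"
    using R by (simp add: power_mult_distrib powr_power mult.commute)
  have "R powr (2 * l) * (?y powr l - 1 - l * (?y - 1)) \<le> R powr (2 * l) * (l\<^sup>2 * 3 powr l * (?y - 1)\<^sup>2)"
    using powr_tangent_upper[OF y l] by (rule mult_left_mono) simp
  also have "\<dots> = (l\<^sup>2 * 3 powr l) * (R powr (2 * l) * (?y - 1)\<^sup>2)" by simp
  also have "\<dots> \<le> (l\<^sup>2 * 3 powr l) * 9" using y2 by (rule mult_left_mono) simp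
  finally have 1: "R powr (2 * l) * (?y powr l - 1 - l * (?y - 1)) \<le> 9 * (l\<^sup>2 * 3 powr l)" by simp
  have "(R powr (l - 1) * ?d)\<^sup>2 \<le> 1" using z by (intro power_le_one) auto
  then have "l * (R powr (l - 1) * ?d)\<^sup>2 \<le> l" using l by (simp add: mult_left_le)
  with 1 show ?thesis using R by (subst peak_div_eq) auto
qed

text \<open>The Gaussian is traded for the integrable power h of the distance rescaled by
  \<open>R powr (l - 1)\<close>. Undoing the scaling contributes R powr (-2n(l-1)) to the integral,
  and the r-th root of that to the norm.\<close>

lemma peak_norm_upper:
  fixes i :: "'n :: finite"
  assumes l: "1 \<le> l" and \<beta>: "0 < \<beta>" and p: "1 \<le> p"
  obtains C where "\<And>R. 1 \<le> R \<Longrightarrow> peak l \<beta> i R \<in> fock_space l \<beta> \<rho> p \<and>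
    fock_norm l \<beta> \<rho> p (peak l \<beta> i R) \<le> C * R powr (\<rho> - real (2 * CARD('n)) * (l - 1) / enn2real p)"
proof -
  \<comment> \<open>One more than the real dimension, so that the r-th power of the majorant is
    integrable for every r \<ge> 1.\<close>
  let ?K = "real (2 * CARD('n)) + 1"
  let ?w = "\<lambda>R. axis i (complex_of_real R)"
  obtain B where B: "0 < B" "\<And>t. 0 \<le> t \<Longrightarrow> (1 + t) powr (\<bar>\<rho>\<bar> + ?K) * exp (- (\<beta> / 2 * l) * t\<^sup>2) \<le> B"
    using gaussian_times_powr_bounded[of "\<beta> / 2 * l" "\<bar>\<rho>\<bar> + ?K"] \<beta> l by auto
  define h where "h R z = (1 + norm (R powr (l - 1) *\<^sub>R (z - ?w R))) powr - ?K" for R and z :: "complex ^ 'n"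
  have pointwise: "weighted_abs l \<beta> \<rho> (peak l \<beta> i R) z \<le> B * 2 powr \<bar>\<rho>\<bar> * R powr \<rho> * h R z"
    if R: "1 \<le> R" for R z
  proof -
    define t where "t = R powr (l - 1) * norm (z - ?w R)"
    have t0: "0 \<le> t" by (simp add: t_def)
    \<comment> \<open>Since the scaling factor is at least 1, the cost of moving the weight to the
      centre can be measured in the rescaled distance t as well.\<close>
    have "1 \<le> R powr (l - 1)" using R l by (simp add: ge_one_powr_ge_zero)
    from mult_right_mono[OF this, of "norm (z - ?w R)"] have dt: "norm (z - ?w R) \<le> t" by (simp add: t_def)
    have h: "h R z = (1 + t) powr - ?K" by (simp add: h_def t_def)
    have "(1 + norm z) powr \<rho> \<le> (1 + norm (?w R)) powr \<rho> * (1 + norm (z - ?w R)) powr \<bar>\<rho>\<bar>"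
      by (rule one_plus_norm_powr_le)
    also have "\<dots> \<le> (2 powr \<bar>\<rho>\<bar> * R powr \<rho>) * (1 + t) powr \<bar>\<rho>\<bar>"
      using powr_comparable[of "1 + R" 2 R \<rho>] R dt by (intro mult_mono powr_mono2) auto
    finally have 1: "(1 + norm z) powr \<rho> \<le> (2 powr \<bar>\<rho>\<bar> * R powr \<rho>) * (1 + t) powr \<bar>\<rho>\<bar>" .
    have "\<beta> / 2 * (l * t\<^sup>2) \<le> \<beta> / 2 * peak_div l i R z"
      using peak_div_ge[of R l z i] R l \<beta> by (intro mult_left_mono) (auto simp: t_def)
    then have 2: "exp (- (\<beta> / 2) * peak_div l i R z) \<le> exp (- (\<beta> / 2 * l) * t\<^sup>2)" by simp
    have "weighted_abs l \<beta> \<rho> (peak l \<beta> i R) z \<le>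
        ((2 powr \<bar>\<rho>\<bar> * R powr \<rho>) * (1 + t) powr \<bar>\<rho>\<bar>) * exp (- (\<beta> / 2 * l) * t\<^sup>2)"
      unfolding weighted_abs_peak[OF less_le_trans[OF zero_less_one R]]
      by (intro mult_mono 1 2) auto
    also have "\<dots> = (2 powr \<bar>\<rho>\<bar> * R powr \<rho>) * (((1 + t) powr (\<bar>\<rho>\<bar> + ?K) * exp (- (\<beta> / 2 * l) * t\<^sup>2)) * (1 + t) powr - ?K)"
    proof -
      have "(1 + t) powr (\<bar>\<rho>\<bar> + ?K) * (1 + t) powr - ?K = (1 + t) powr \<bar>\<rho>\<bar>"
        by (subst powr_add[symmetric]) simp
      from this[symmetric] show ?thesis by (simp only: mult_ac)
    qed
    also have "\<dots> \<le> (2 powr \<bar>\<rho>\<bar> * R powr \<rho>) * (B * (1 + t) powr - ?K)"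
      using B(2)[OF t0] by (intro mult_left_mono mult_right_mono) auto
    finally show ?thesis by (simp add: h mult_ac)
  qed
  have h_le: "h R z \<le> 1" "0 \<le> h R z" for R z
    using powr_mono2'[of "- ?K" 1 "1 + norm (R powr (l - 1) *\<^sub>R (z - ?w R))"] by (auto simp: h_def)
  show ?thesis
    using p
  proof (cases rule: exponent_cases)
    case top
    show ?thesis
    proof (rule that[of "B * 2 powr \<bar>\<rho>\<bar>"])
      fix R :: real assume R: "1 \<le> R"
      have "weighted_abs l \<beta> \<rho> (peak l \<beta> i R) z \<le> B * 2 powr \<bar>\<rho>\<bar> * R powr \<rho>" for z
        by (rule order_trans[OF pointwise[OF R] mult_left_le]) (use h_le B(1) in auto)
      then show "peak l \<beta> i R \<in> fock_space l \<beta> \<rho> p \<and>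
        fock_norm l \<beta> \<rho> p (peak l \<beta> i R) \<le> B * 2 powr \<bar>\<rho>\<bar> * R powr (\<rho> - real (2 * CARD('n)) * (l - 1) / enn2real p)"
        unfolding top by (auto simp del: fock_norm_top intro!: fock_norm_top_leI bdd_aboveI2 entire_peak)
    qed
  next
    case (real r)
    define I where "I = enn2real (\<integral>\<^sup>+z. ennreal ((1 + norm z) powr - (?K * r)) \<partial>(dV :: (complex ^ 'n) measure))"
    have "real (2 * CARD('n)) < ?K * r"
    proof -
      have "?K * 1 \<le> ?K * r" using real(2) by (intro mult_left_mono) auto
      then show ?thesis by (rule less_le_trans[rotated]) simp
    qed
    from nn_integral_one_plus_norm_powr_finite[OF this]
    have I: "(\<integral>\<^sup>+z. ennreal ((1 + norm z) powr - (?K * r)) \<partial>(dV :: (complex ^ 'n) measure)) = ennreal I" "0 \<le> I"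
      by (auto simp: I_def)
    show ?thesis
    proof (rule that[of "B * 2 powr \<bar>\<rho>\<bar> * I powr (1 / r)"])
      fix R :: real assume R: "1 \<le> R"
      let ?s = "R powr (l - 1)" and ?d = "real (2 * CARD('n))"
      have hm: "h R \<in> borel_measurable borel" unfolding h_def by measurable
      have "(\<integral>\<^sup>+z. ennreal (h R z powr r) \<partial>dV) =
          (\<integral>\<^sup>+z. (\<lambda>u. ennreal ((1 + norm u) powr - (?K * r))) (?s *\<^sub>R (z - ?w R)) \<partial>dV)"
        by (simp only: h_def powr_powr minus_mult_left)
      also have "\<dots> = ennreal (?s powr - ?d) * ennreal I"
      proof (subst nn_integral_dV_affine)
        show "0 < ?s" using R by simp
      qed (simp_all only: I, measurable)
      also have "\<dots> = ennreal ((?s powr (- ?d / r) * I powr (1 / r)) powr r)"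
        using real I by (simp add: powr_mult powr_powr flip: ennreal_mult')
      finally have int: "(\<integral>\<^sup>+z. ennreal (h R z powr r) \<partial>dV) = ennreal ((?s powr (- ?d / r) * I powr (1 / r)) powr r)" .
      have K: "0 \<le> B * 2 powr \<bar>\<rho>\<bar> * R powr \<rho>" and I': "0 \<le> ?s powr (- ?d / r) * I powr (1 / r)"
        using B(1) by auto
      have "R powr \<rho> * ?s powr (- ?d / r) = R powr (\<rho> - ?d * (l - 1) / enn2real p)"
        using real by (simp add: powr_powr algebra_simps flip: powr_add)
      from this[symmetric] have eq: "B * 2 powr \<bar>\<rho>\<bar> * R powr \<rho> * (?s powr (- ?d / r) * I powr (1 / r)) =
          B * 2 powr \<bar>\<rho>\<bar> * I powr (1 / r) * R powr (\<rho> - ?d * (l - 1) / enn2real p)"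
        by (simp only: mult_ac)
      show "peak l \<beta> i R \<in> fock_space l \<beta> \<rho> p \<and>
        fock_norm l \<beta> \<rho> p (peak l \<beta> i R) \<le> B * 2 powr \<bar>\<rho>\<bar> * I powr (1 / r) * R powr (\<rho> - ?d * (l - 1) / enn2real p)"
        using fock_norm_le_of_pointwise_powr[OF real(2) entire_peak K pointwise[OF R] h_le(2) hm eq_refl[OF int] I']
        unfolding eq real(1)[symmetric] by blast
    qed
  qed
qed

lemma peak_norm_lower:
  fixes i :: "'n :: finite"
  assumes l: "1 \<le> l" and \<beta>: "0 < \<beta>" and q: "1 \<le> q"
  obtains c where "0 < c" "\<And>R. 1 \<le> R \<Longrightarrow> peak l \<beta> i R \<in> fock_space l \<beta> \<eta> q \<Longrightarrow>
    c * R powr (\<eta> - real (2 * CARD('n)) * (l - 1) / enn2real q) \<le> fock_norm l \<beta> \<eta> q (peak l \<beta> i R)"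
proof -
  let ?w = "\<lambda>R. axis i (complex_of_real R)"
  \<comment> \<open>The exponential comes from \<open>peak_div_le\<close>. One factor
    \<open>2 powr \<bar>\<eta>\<bar>\<close> pays for passing between R and 1 + R, the other for
    passing between the centre and z.\<close>
  define c where "c = exp (- (\<beta> / 2) * (9 * (l\<^sup>2 * 3 powr l) + l)) / (2 powr \<bar>\<eta>\<bar> * 2 powr \<bar>\<eta>\<bar>)"
  have c: "0 < c" by (simp add: c_def)
  have pointwise: "c * R powr \<eta> \<le> weighted_abs l \<beta> \<eta> (peak l \<beta> i R) z"
    if R: "1 \<le> R" and z: "R powr (l - 1) * norm (z - ?w R) \<le> 1 / 2" for R z
  proof -
    have "1 \<le> R powr (l - 1)" using R l by (simp add: ge_one_powr_ge_zero)
    from mult_right_mono[OF this, of "norm (z - ?w R)"] have d: "norm (z - ?w R) \<le> 1" using z by simp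
    have "R powr \<eta> \<le> 2 powr \<bar>\<eta>\<bar> * (1 + R) powr \<eta>" using R by (intro powr_comparable) auto
    also have "(1 + R) powr \<eta> \<le> (1 + norm z) powr \<eta> * (1 + norm (?w R - z)) powr \<bar>\<eta>\<bar>"
      using one_plus_norm_powr_le[of "?w R" \<eta> z] R by simp
    also have "\<dots> \<le> (1 + norm z) powr \<eta> * 2 powr \<bar>\<eta>\<bar>"
      using d by (intro mult_left_mono powr_mono2) (auto simp: norm_minus_commute)
    finally have 1: "R powr \<eta> / (2 powr \<bar>\<eta>\<bar> * 2 powr \<bar>\<eta>\<bar>) \<le> (1 + norm z) powr \<eta>"
      by (simp add: field_simps)
    have 2: "exp (- (\<beta> / 2) * (9 * (l\<^sup>2 * 3 powr l) + l)) \<le> exp (- (\<beta> / 2) * peak_div l i R z)"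
      using peak_div_le[OF R l z] \<beta> by simp
    have "c * R powr \<eta> = (R powr \<eta> / (2 powr \<bar>\<eta>\<bar> * 2 powr \<bar>\<eta>\<bar>)) * exp (- (\<beta> / 2) * (9 * (l\<^sup>2 * 3 powr l) + l))"
      by (simp add: c_def)
    also have "\<dots> \<le> (1 + norm z) powr \<eta> * exp (- (\<beta> / 2) * peak_div l i R z)"
      by (intro mult_mono 1 2) auto
    also have "\<dots> = weighted_abs l \<beta> \<eta> (peak l \<beta> i R) z"
      using R by (subst weighted_abs_peak) auto
    finally show ?thesis .
  qed
  show ?thesis
    using q
  proof (cases rule: exponent_cases)
    case top
    show ?thesis
    proof (rule that[OF c])
      fix R :: real assume R: "1 \<le> R" and mem: "peak l \<beta> i R \<in> fock_space l \<beta> \<eta> q"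
      have "c * R powr \<eta> \<le> weighted_abs l \<beta> \<eta> (peak l \<beta> i R) (?w R)"
        by (rule pointwise[OF R]) simp
      also have "\<dots> \<le> fock_norm l \<beta> \<eta> q (peak l \<beta> i R)"
        using mem unfolding top by (auto intro: cSUP_upper)
      finally show "c * R powr (\<eta> - real (2 * CARD('n)) * (l - 1) / enn2real q) \<le> fock_norm l \<beta> \<eta> q (peak l \<beta> i R)"
        unfolding top by simp
    qed
  next
    case (real r)
    let ?d = "real (2 * CARD('n))"
    show ?thesis
    proof (rule that[of "c * (1 / 2) powr (?d / r)"])
      fix R :: real assume R: "1 \<le> R" and mem: "peak l \<beta> i R \<in> fock_space l \<beta> \<eta> q"
      let ?T = "weighted_abs l \<beta> \<eta> (peak l \<beta> i R)" and ?N = "fock_norm l \<beta> \<eta> q (peak l \<beta> i R)"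
      let ?B = "ball (?w R) (R powr (1 - l) / 2)"
      have "ennreal ((c * (1 / 2) powr (?d / r) * R powr (\<eta> - ?d * (l - 1) / r)) powr r)
          = ennreal ((c * R powr \<eta>) powr r) * ennreal ((R powr (1 - l) / 2) ^ (2 * CARD('n)))"
      proof -
        have "(R powr (1 - l) / 2) ^ (2 * CARD('n)) = (R powr (1 - l) * (1 / 2)) powr ?d"
          using R by (subst powr_realpow) auto
        also have "\<dots> = R powr ((1 - l) * ?d) * (1 / 2) powr ?d"
          using R by (simp only: powr_mult powr_powr)
        also have "(1 - l) * ?d = (- ?d * (l - 1) / r) * r" using real(2) by (simp add: field_simps)
        also have "(1 / 2 :: real) powr ?d = (1 / 2) powr (?d / r * r)" using real(2) by simp
        also have "R powr ((- ?d * (l - 1) / r) * r) * (1 / 2) powr (?d / r * r) =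
            ((1 / 2) powr (?d / r) * R powr (- ?d * (l - 1) / r)) powr r"
          by (simp only: powr_mult powr_powr mult.commute)
        finally have "(c * R powr \<eta>) powr r * (R powr (1 - l) / 2) ^ (2 * CARD('n)) =
            ((c * R powr \<eta>) * ((1 / 2) powr (?d / r) * R powr (- ?d * (l - 1) / r))) powr r"
          using c by (simp add: powr_mult)
        also have "(c * R powr \<eta>) * ((1 / 2) powr (?d / r) * R powr (- ?d * (l - 1) / r)) =
            c * (1 / 2) powr (?d / r) * R powr (\<eta> - ?d * (l - 1) / r)"
          by (simp add: mult_ac diff_divide_distrib powr_add[symmetric])
        finally show ?thesis using c by (simp flip: ennreal_mult')
      qed
      also have "\<dots> = (\<integral>\<^sup>+z. ennreal ((c * R powr \<eta>) powr r) * indicator ?B z \<partial>dV)"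
        by (subst nn_integral_cmult_indicator) (auto simp: emeasure_dV_ball)
      also have "\<dots> \<le> (\<integral>\<^sup>+z. ennreal (?T z powr r) \<partial>dV)"
      proof (intro nn_integral_mono)
        fix z
        show "ennreal ((c * R powr \<eta>) powr r) * indicator ?B z \<le> ennreal (?T z powr r)"
        proof (cases "z \<in> ?B")
          case True
          have "R powr (l - 1) * norm (z - ?w R) \<le> R powr (l - 1) * (R powr (1 - l) / 2)"
            using True by (intro mult_left_mono) (auto simp: dist_norm norm_minus_commute)
          also have "\<dots> = 1 / 2" using R by (simp flip: powr_add)
          finally have "c * R powr \<eta> \<le> ?T z" by (rule pointwise[OF R])
          then show ?thesis
            using True c real(2) by (auto intro!: ennreal_leI powr_mono2)
        qed simp
      qed
      also have "\<dots> = ennreal (?N powr r)"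
        using mem real by (simp add: fock_norm_powr del: mem_fock_space_ennreal)
      finally have "(c * (1 / 2) powr (?d / r) * R powr (\<eta> - ?d * (l - 1) / r)) powr r \<le> ?N powr r"
        by simp
      then have "c * (1 / 2) powr (?d / r) * R powr (\<eta> - ?d * (l - 1) / r) \<le> ?N"
        by (rule powr_le_powr_imp_le) (use c real(2) fock_norm_nonneg[OF q mem] in auto)
      then show "c * (1 / 2) powr (?d / r) * R powr (\<eta> - ?d * (l - 1) / enn2real q) \<le> ?N"
        using real by simp
    qed (use c in simp)
  qed
qed

lemma fock_embeds_peak_exponents:
  assumes l: "1 \<le> l" and \<beta>: "0 < \<beta>" and p: "1 \<le> p" and q: "1 \<le> q"
    and emb: "fock_embeds TYPE('n::finite) l \<beta> \<rho> p \<eta> q"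
  shows "\<eta> - real (2 * CARD('n)) * (l - 1) / enn2real q \<le> \<rho> - real (2 * CARD('n)) * (l - 1) / enn2real p"
proof -
  fix i :: 'n
  obtain C where C: "\<And>R. 1 \<le> R \<Longrightarrow> peak l \<beta> i R \<in> fock_space l \<beta> \<rho> p \<and>
      fock_norm l \<beta> \<rho> p (peak l \<beta> i R) \<le> C * R powr (\<rho> - real (2 * CARD('n)) * (l - 1) / enn2real p)"
    using peak_norm_upper[OF l \<beta> p] by blast
  obtain c where c: "0 < c" "\<And>R. 1 \<le> R \<Longrightarrow> peak l \<beta> i R \<in> fock_space l \<beta> \<eta> q \<Longrightarrow>
      c * R powr (\<eta> - real (2 * CARD('n)) * (l - 1) / enn2real q) \<le> fock_norm l \<beta> \<eta> q (peak l \<beta> i R)"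
    using peak_norm_lower[OF l \<beta> q] by blast
  obtain K where sub: "fock_space l \<beta> \<rho> p \<subseteq> (fock_space l \<beta> \<eta> q :: (complex ^ 'n \<Rightarrow> complex) set)"
    and K: "\<And>f :: complex ^ 'n \<Rightarrow> complex. f \<in> fock_space l \<beta> \<rho> p \<Longrightarrow> fock_norm l \<beta> \<eta> q f \<le> K * fock_norm l \<beta> \<rho> p f"
    using emb unfolding fock_embeds_def embeds_def by blast
  show ?thesis
  proof (rule powr_le_imp_exponent_le[OF c(1)])
    fix J :: nat assume "1 \<le> J"
    then have J: "1 \<le> real J" by simp
    let ?f = "peak l \<beta> i (real J)"
    have f: "?f \<in> fock_space l \<beta> \<rho> p" using C[OF J] by simp
    have "c * real J powr (\<eta> - real (2 * CARD('n)) * (l - 1) / enn2real q) \<le> fock_norm l \<beta> \<eta> q ?f"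
      using f sub by (intro c(2)[OF J]) auto
    also have "\<dots> \<le> K * fock_norm l \<beta> \<rho> p ?f" using f by (rule K)
    also have "\<dots> \<le> \<bar>K\<bar> * fock_norm l \<beta> \<rho> p ?f"
      using fock_norm_nonneg[OF p f] by (intro mult_right_mono) auto
    also have "\<dots> \<le> \<bar>K\<bar> * (C * real J powr (\<rho> - real (2 * CARD('n)) * (l - 1) / enn2real p))"
      using C[OF J] by (intro mult_left_mono) auto
    finally show "c * real J powr (\<eta> - real (2 * CARD('n)) * (l - 1) / enn2real q) \<le>
        (\<bar>K\<bar> * C) * real J powr (\<rho> - real (2 * CARD('n)) * (l - 1) / enn2real p)" by (simp add: mult.assoc)
  qed
qed

subsection \<open>Normalised monomials\<close>

text \<open>The bound must be uniform in the centre v. Splitting the integers at the floor N of v,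
  the terms on each side have distinct integer lower bounds for their distance to v, so each side is
  dominated by the convergent series of 1/(1+k)^2.\<close>

lemma sum_gaussian_bounded:
  fixes c :: real
  assumes "0 < c"
  obtains B where "0 < B" "\<And>F v. finite F \<Longrightarrow> (0 :: real) \<le> v \<Longrightarrow> (\<Sum>j\<in>F. exp (- c * (real j - v)\<^sup>2)) \<le> B"
proof -
  let ?u = "\<lambda>k :: nat. 1 / (1 + real k)\<^sup>2"
  have "summable (\<lambda>k. inverse (real (Suc k) ^ 2))"
    using inverse_power_summable[of 2, where 'a = real] by (subst summable_Suc_iff) simp
  then have u: "summable ?u" by (simp add: inverse_eq_divide add_ac)
  obtain C where C: "0 < C" "\<And>t. 0 \<le> t \<Longrightarrow> (1 + t) powr 2 * exp (- c * t\<^sup>2) \<le> C"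
    using gaussian_times_powr_bounded[OF assms, of 2] by blast
  have g: "exp (- c * x\<^sup>2) \<le> C * ?u k" if "real k \<le> \<bar>x\<bar>" for x k
  proof -
    have "(1 + real k)\<^sup>2 * exp (- c * x\<^sup>2) \<le> (1 + \<bar>x\<bar>) powr 2 * exp (- c * \<bar>x\<bar>\<^sup>2)"
      using that by (intro mult_mono) (auto intro!: power_mono)
    also have "\<dots> \<le> C" by (rule C(2)) simp
    finally show ?thesis by (simp add: field_simps)
  qed
  have sums: "(\<Sum>j\<in>F. ?u (h j)) \<le> suminf ?u" if "finite F" "inj_on h F" for F :: "nat set" and h
  proof -
    have "(\<Sum>j\<in>F. ?u (h j)) = sum ?u (h ` F)" using that by (simp add: sum.reindex)
    also have "\<dots> \<le> suminf ?u" using that u by (intro sum_le_suminf) auto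
    finally show ?thesis .
  qed
  have pos: "0 \<le> suminf ?u" using u by (intro suminf_nonneg) auto
  show ?thesis
  proof (rule that[of "C * (2 * suminf ?u) + 1"])
    show "0 < C * (2 * suminf ?u) + 1" using C(1) pos by (simp add: add_nonneg_pos)
    fix F :: "nat set" and v :: real assume F: "finite F" and v: "0 \<le> v"
    define N where "N = nat \<lfloor>v\<rfloor>"
    have N: "real N \<le> v" "v < real N + 1" using v unfolding N_def by linarith+
    let ?F1 = "F \<inter> {..N}" and ?F2 = "F - {..N}"
    have "(\<Sum>j\<in>F. exp (- c * (real j - v)\<^sup>2)) = (\<Sum>j\<in>?F1. exp (- c * (real j - v)\<^sup>2)) + (\<Sum>j\<in>?F2. exp (- c * (real j - v)\<^sup>2))"
      using F by (rule sum.Int_Diff)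
    \<comment> \<open>Since N \<le> v < N + 1, an index above N is only known to be at distance more
      than j - N - 1.\<close>
    also have "\<dots> \<le> (\<Sum>j\<in>?F1. C * ?u (N - j)) + (\<Sum>j\<in>?F2. C * ?u (j - N - 1))"
      using N by (intro add_mono sum_mono g) (auto simp: of_nat_diff)
    also have "\<dots> = C * ((\<Sum>j\<in>?F1. ?u (N - j)) + (\<Sum>j\<in>?F2. ?u (j - N - 1)))"
      by (simp add: sum_distrib_left distrib_left)
    also have "\<dots> \<le> C * (suminf ?u + suminf ?u)"
      using F C(1) by (intro mult_left_mono add_mono sums) (auto simp: inj_on_def)
    finally show "(\<Sum>j\<in>F. exp (- c * (real j - v)\<^sup>2)) \<le> C * (2 * suminf ?u) + 1" by simp
  qed
qed

text \<open>With exponents \<open>(m i)\<^sup>2\<close> and the right normalisation, the weighted modulus of a monomial is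
  comparable to a Gaussian in \<open>torus_radii l \<beta> z\<close> centred at \<open>m\<close>, at unit scale for all \<open>m\<close>.\<close>

definition torus_radii :: "real \<Rightarrow> real \<Rightarrow> complex ^ 'n::finite \<Rightarrow> 'n \<Rightarrow> real" where
  "torus_radii l \<beta> z i = sqrt (\<beta> * l) * norm z powr (l - 1) * norm (z $ i)"

text \<open>For positive m this is minus the logarithm of the maximum of the monomial times exp
  (-(\<beta>/2) |z|^(2l)). The maximum is attained where \<open>torus_radii\<close> equals m, so the
  normalised peak has height 1.\<close>

definition monom_log_coeff :: "real \<Rightarrow> real \<Rightarrow> ('n::finite \<Rightarrow> nat) \<Rightarrow> real" where
  "monom_log_coeff l \<beta> m =
     (let k = \<lambda>i. (real (m i))\<^sup>2; K = (\<Sum>i\<in>UNIV. k i)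
      in (1 - 1 / l) / 2 * (K * ln K) + K / (2 * l) * (1 + ln (\<beta> * l)) - (\<Sum>i\<in>UNIV. k i * ln (k i)) / 2)"

definition normalized_monom :: "real \<Rightarrow> real \<Rightarrow> ('n::finite \<Rightarrow> nat) \<Rightarrow> complex ^ 'n \<Rightarrow> complex" where
  "normalized_monom l \<beta> m z = of_real (exp (monom_log_coeff l \<beta> m)) * (\<Prod>i\<in>UNIV. z $ i ^ ((m i)\<^sup>2))"

lemma entire_normalized_monom: "entire (normalized_monom l \<beta> m)"
  unfolding normalized_monom_def[abs_def]
  by (intro entire_mult entire_const entire_prod entire_power entire_nth)

lemma torus_radii_nonneg [simp]: "0 \<le> \<beta> * l \<Longrightarrow> 0 \<le> torus_radii l \<beta> z i"
  by (simp add: torus_radii_def)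

lemma sum_torus_radii:
  assumes "0 \<le> \<beta> * l"
  shows "(\<Sum>i\<in>UNIV. (torus_radii l \<beta> z i)\<^sup>2) = \<beta> * l * norm z powr (2 * l)"
proof (cases "z = 0")
  case True
  then show ?thesis by (simp add: torus_radii_def)
next
  case False
  have n: "(\<Sum>i\<in>UNIV. (norm (z $ i))\<^sup>2) = (norm z)\<^sup>2"
    by (simp add: norm_vec_def L2_set_def sum_nonneg)
  have "(\<Sum>i\<in>UNIV. (torus_radii l \<beta> z i)\<^sup>2) = \<beta> * l * ((norm z powr (l - 1))\<^sup>2 * (norm z)\<^sup>2)"
    using assms by (simp add: torus_radii_def power_mult_distrib sum_distrib_left mult.assoc flip: n)
  also have "(norm z powr (l - 1))\<^sup>2 * (norm z)\<^sup>2 = (norm z powr (l - 1) * norm z)\<^sup>2"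
    by (simp add: power_mult_distrib)
  also have "norm z powr (l - 1) * norm z = norm z powr l" using False by (simp add: powr_diff)
  also have "(norm z powr l)\<^sup>2 = norm z powr (2 * l)" by (rule powr_square)
  finally show ?thesis .
qed

text \<open>The summand of the generalised Kullback-Leibler divergence of positive k from w, for
  vectors whose totals may differ.\<close>

definition entropy_term :: "real \<Rightarrow> real \<Rightarrow> real" where
  "entropy_term k w = k * ln (k / w) + w - k"

lemma entropy_term_nonneg:
  assumes "0 < k" "0 < w"
  shows "0 \<le> entropy_term k w"
proof -
  have "ln (w / k) \<le> w / k - 1" using assms by (intro ln_le_minus_one) simp
  then have "k * ln (w / k) \<le> k * (w / k - 1)" using assms by (intro mult_left_mono) auto
  then show ?thesis using assms by (simp add: entropy_term_def ln_div algebra_simps)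
qed

text \<open>Applying ln x \<le> x - 1 to v/m rather than to its square makes the remainder exactly
  (m - v)^2, a Gaussian exponent whose width does not depend on m.\<close>

lemma entropy_term_ge:
  assumes "0 < m" "0 < v"
  shows "(m - v)\<^sup>2 \<le> entropy_term (m\<^sup>2) (v\<^sup>2)"
proof -
  have "ln (v / m) \<le> v / m - 1" using assms by (intro ln_le_minus_one) simp
  then have "2 * m\<^sup>2 * ln (v / m) \<le> 2 * m\<^sup>2 * (v / m - 1)" using assms by (intro mult_left_mono) auto
  also have "\<dots> = 2 * m * v - 2 * m\<^sup>2" using assms by (simp add: field_simps power2_eq_square)
  finally have "2 * m\<^sup>2 * (ln v - ln m) \<le> 2 * m * v - 2 * m\<^sup>2" using assms by (simp add: ln_div)
  moreover have "ln (m\<^sup>2 / v\<^sup>2) = 2 * (ln m - ln v)" using assms by (simp add: ln_div ln_realpow)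
  then have "entropy_term (m\<^sup>2) (v\<^sup>2) = m\<^sup>2 * (2 * (ln m - ln v)) + v\<^sup>2 - m\<^sup>2"
    by (simp add: entropy_term_def)
  ultimately show ?thesis
    by (simp add: power2_eq_square algebra_simps)
qed

lemma entropy_term_le:
  assumes "0 < m" "1 \<le> v" "m \<le> v" "v \<le> m + 1"
  shows "entropy_term (m\<^sup>2) (v\<^sup>2) \<le> 4"
proof -
  have "ln (m\<^sup>2 / v\<^sup>2) \<le> m\<^sup>2 / v\<^sup>2 - 1" using assms by (intro ln_le_minus_one) simp
  then have "m\<^sup>2 * ln (m\<^sup>2 / v\<^sup>2) \<le> m\<^sup>2 * (m\<^sup>2 / v\<^sup>2 - 1)" by (intro mult_left_mono) auto
  then have "entropy_term (m\<^sup>2) (v\<^sup>2) \<le> m\<^sup>2 * (m\<^sup>2 / v\<^sup>2 - 1) + v\<^sup>2 - m\<^sup>2"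
    by (simp add: entropy_term_def)
  also have "\<dots> = ((v - m) * ((v + m) / v))\<^sup>2"
    using assms by (simp add: field_simps power2_eq_square)
  also have "\<dots> \<le> (1 * 2)\<^sup>2"
  proof (rule power_mono)
    show "(v - m) * ((v + m) / v) \<le> 1 * 2"
      using assms by (intro mult_mono) (auto simp: divide_simps)
    show "0 \<le> (v - m) * ((v + m) / v)"
      using assms by (intro mult_nonneg_nonneg divide_nonneg_nonneg) auto
  qed
  finally show ?thesis by simp
qed

text \<open>The log sum inequality: merging coordinates can only lower the divergence. It is ln x
  \<le> x - 1 at the ratios of w to k rescaled to equal totals, where the upper bounds add up to
  0.\<close>

lemma entropy_term_sum_le:
  fixes k w :: "'n::finite \<Rightarrow> real"
  assumes k: "\<And>i. 0 < k i" and w: "\<And>i. 0 < w i"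
  shows "entropy_term (\<Sum>i\<in>UNIV. k i) (\<Sum>i\<in>UNIV. w i) \<le> (\<Sum>i\<in>UNIV. entropy_term (k i) (w i))"
proof -
  let ?K = "\<Sum>i\<in>UNIV. k i" and ?W = "\<Sum>i\<in>UNIV. w i"
  have pos: "0 < ?K" "0 < ?W" using k w by (auto intro!: sum_pos)
  have "(\<Sum>i\<in>UNIV. k i * (ln (?K / ?W) - ln (k i / w i))) \<le> (\<Sum>i\<in>UNIV. k i * (?K * w i / (?W * k i) - 1))"
  proof (intro sum_mono mult_left_mono)
    fix i
    have "ln (?K / ?W) - ln (k i / w i) = ln (?K * w i / (?W * k i))"
      using pos k[of i] w[of i] by (simp add: ln_div ln_mult)
    also have "\<dots> \<le> ?K * w i / (?W * k i) - 1"
      using pos k[of i] w[of i] by (intro ln_le_minus_one) simp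
    finally show "ln (?K / ?W) - ln (k i / w i) \<le> ?K * w i / (?W * k i) - 1" .
  qed (use k less_imp_le in auto)
  also have "\<dots> = (\<Sum>i\<in>UNIV. ?K / ?W * w i - k i)"
  proof (intro sum.cong refl)
    fix i show "k i * (?K * w i / (?W * k i) - 1) = ?K / ?W * w i - k i"
      using k[of i] pos by (simp add: field_simps)
  qed
  also have "\<dots> = ?K / ?W * ?W - ?K" by (simp only: sum_subtractf sum_distrib_left)
  also have "\<dots> = 0" using pos by simp
  finally have "?K * ln (?K / ?W) \<le> (\<Sum>i\<in>UNIV. k i * ln (k i / w i))"
    by (simp add: right_diff_distrib sum_subtractf sum_distrib_right)
  then show ?thesis by (simp add: entropy_term_def sum_subtractf sum.distrib)
qed

text \<open>Both log |z| and log |z_i| are affine in logarithms of the radii and of their total. The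
  term for the totals reflects the factor |z|^(l-1) shared by all radii; its coefficient vanishes
  for l = 1, where the weight splits into one-variable weights.\<close>

lemma normalized_monom_weighted:
  fixes m :: "'n::finite \<Rightarrow> nat" and z :: "complex ^ 'n"
  assumes l: "1 \<le> l" and \<beta>: "0 < \<beta>" and m: "\<And>i. 0 < m i" and z: "\<And>i. z $ i \<noteq> 0"
  shows "norm (normalized_monom l \<beta> m z) * exp (- (\<beta> / 2) * norm z powr (2 * l)) =
    exp ((1 - 1 / l) / 2 * entropy_term (\<Sum>i\<in>UNIV. (real (m i))\<^sup>2) (\<Sum>i\<in>UNIV. (torus_radii l \<beta> z i)\<^sup>2)
         - (\<Sum>i\<in>UNIV. entropy_term ((real (m i))\<^sup>2) ((torus_radii l \<beta> z i)\<^sup>2)) / 2)"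
proof -
  let ?k = "\<lambda>i. (real (m i))\<^sup>2" and ?v = "\<lambda>i. (torus_radii l \<beta> z i)\<^sup>2"
  define K where "K = (\<Sum>i\<in>UNIV. ?k i)"
  define V where "V = (\<Sum>i\<in>UNIV. ?v i)"
  have z0: "0 < norm z" using z by auto
  have K: "0 < K" unfolding K_def using m by (auto intro!: sum_pos)
  have V: "V = \<beta> * l * norm z powr (2 * l)" unfolding V_def using \<beta> l by (intro sum_torus_radii) simp
  have V0: "0 < V" unfolding V using \<beta> l z0 by simp
  have lnV: "ln V = ln (\<beta> * l) + 2 * l * ln (norm z)"
    unfolding V using \<beta> l z0 by (simp add: ln_mult)
  have lnv: "ln (?v i) = ln (\<beta> * l) + 2 * (l - 1) * ln (norm z) + 2 * ln (norm (z $ i))" for i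
  proof -
    have "?v i = (\<beta> * l) * norm z powr (2 * (l - 1)) * (norm (z $ i))\<^sup>2"
      using \<beta> l by (simp add: torus_radii_def power_mult_distrib powr_square)
    then show ?thesis using \<beta> l z0 z[of i] by (simp add: ln_mult ln_realpow)
  qed
  have v0: "0 < ?v i" for i
    using \<beta> l z0 z[of i] by (simp add: torus_radii_def zero_less_mult_iff)
  have prod: "(\<Prod>i\<in>UNIV. norm (z $ i) ^ ((m i)\<^sup>2)) = exp (\<Sum>i\<in>UNIV. ?k i * ln (norm (z $ i)))"
    unfolding exp_sum[OF finite]
    by (intro prod.cong refl) (use z in \<open>simp add: exp_of_nat_mult flip: of_nat_power\<close>)
  have lhs: "norm (normalized_monom l \<beta> m z) * exp (- (\<beta> / 2) * norm z powr (2 * l)) =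
      exp (monom_log_coeff l \<beta> m + (\<Sum>i\<in>UNIV. ?k i * ln (norm (z $ i))) - V / (2 * l))"
  proof -
    have "norm (normalized_monom l \<beta> m z) = exp (monom_log_coeff l \<beta> m + (\<Sum>i\<in>UNIV. ?k i * ln (norm (z $ i))))"
      by (simp add: normalized_monom_def norm_mult prod_norm[symmetric] norm_power prod exp_add)
    moreover have "V / (2 * l) = \<beta> / 2 * norm z powr (2 * l)" using l by (simp add: V)
    ultimately show ?thesis by (simp flip: exp_add)
  qed
  define c where "c = ln (\<beta> * l) + 2 * (l - 1) * ln (norm z)"
  have "?k i * ln (norm (z $ i)) = ?k i * ln (?v i) / 2 - c / 2 * ?k i" for i
    unfolding lnv c_def[symmetric] by (simp add: field_simps)
  then have S: "(\<Sum>i\<in>UNIV. ?k i * ln (norm (z $ i))) = (\<Sum>i\<in>UNIV. ?k i * ln (?v i)) / 2 - c / 2 * K"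
    by (simp only: sum_subtractf K_def sum_divide_distrib sum_distrib_left)
  have P: "(\<Sum>i\<in>UNIV. entropy_term (?k i) (?v i)) = (\<Sum>i\<in>UNIV. ?k i * ln (?k i)) - (\<Sum>i\<in>UNIV. ?k i * ln (?v i)) + V - K"
  proof -
    have "entropy_term (?k i) (?v i) = ?k i * ln (?k i) - ?k i * ln (?v i) + ?v i - ?k i" for i
      using m[of i] v0[of i] by (simp add: entropy_term_def ln_div right_diff_distrib)
    then show ?thesis by (simp add: sum.distrib sum_subtractf K_def V_def)
  qed
  have Q: "entropy_term K V = K * (ln K - ln V) + V - K"
    using K V0 by (simp add: entropy_term_def ln_div)
  have "monom_log_coeff l \<beta> m + (\<Sum>i\<in>UNIV. ?k i * ln (norm (z $ i))) - V / (2 * l) =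
      (1 - 1 / l) / 2 * entropy_term K V - (\<Sum>i\<in>UNIV. entropy_term (?k i) (?v i)) / 2"
    unfolding P Q S lnV monom_log_coeff_def Let_def K_def[symmetric] c_def
    using l by (simp add: field_simps)
  then show ?thesis unfolding lhs K_def V_def by (simp only:)
qed

text \<open>By the log sum inequality the term for the totals cancels at most the fraction 1 - 1/l
  of the coordinate divergences, so the fraction 1/l survives.\<close>

lemma normalized_monom_weighted_le:
  fixes m :: "'n::finite \<Rightarrow> nat"
  assumes l: "1 \<le> l" and \<beta>: "0 < \<beta>" and m: "\<And>i. 0 < m i"
  shows "norm (normalized_monom l \<beta> m z) * exp (- (\<beta> / 2) * norm z powr (2 * l)) \<le>
    exp (- (\<Sum>i\<in>UNIV. (real (m i) - torus_radii l \<beta> z i)\<^sup>2) / (2 * l))"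
proof (cases "\<exists>i. z $ i = 0")
  case True
  then have "normalized_monom l \<beta> m z = 0"
    using m by (auto simp: normalized_monom_def prod_zero_iff power_0_left)
  then show ?thesis by simp
next
  case False
  let ?P = "\<Sum>i\<in>UNIV. entropy_term ((real (m i))\<^sup>2) ((torus_radii l \<beta> z i)\<^sup>2)"
  let ?Q = "entropy_term (\<Sum>i\<in>UNIV. (real (m i))\<^sup>2) (\<Sum>i\<in>UNIV. (torus_radii l \<beta> z i)\<^sup>2)"
  have v: "0 < torus_radii l \<beta> z i" for i
  proof -
    have "z \<noteq> 0" using False by auto
    then show ?thesis using False \<beta> l by (simp add: torus_radii_def zero_less_mult_iff)
  qed
  have v_nz: "torus_radii l \<beta> z i \<noteq> 0" for i using v[of i] by simp
  have "?Q \<le> ?P" using m v_nz by (intro entropy_term_sum_le) auto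
  then have "(1 - 1 / l) / 2 * ?Q \<le> (1 - 1 / l) / 2 * ?P"
    using l by (intro mult_left_mono) auto
  then have "(1 - 1 / l) / 2 * ?Q - ?P / 2 \<le> - ?P / (2 * l)" by (simp add: field_simps)
  also have "\<dots> \<le> - (\<Sum>i\<in>UNIV. (real (m i) - torus_radii l \<beta> z i)\<^sup>2) / (2 * l)"
    using l m v by (intro divide_right_mono) (auto intro!: sum_mono entropy_term_ge)
  finally show ?thesis
    using False by (subst normalized_monom_weighted[OF l \<beta> m]) auto
qed

text \<open>Here the term for the totals helps and is dropped. Each of the n coordinate divergences
  is at most 4 and enters with the factor 1/2.\<close>

lemma normalized_monom_weighted_ge:
  fixes m :: "'n::finite \<Rightarrow> nat"
  assumes l: "1 \<le> l" and \<beta>: "0 < \<beta>" and m: "\<And>i. 0 < m i"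
    and v: "\<And>i. real (m i) \<le> torus_radii l \<beta> z i" "\<And>i. torus_radii l \<beta> z i \<le> real (m i) + 1"
  shows "exp (- 2 * real CARD('n)) \<le> norm (normalized_monom l \<beta> m z) * exp (- (\<beta> / 2) * norm z powr (2 * l))"
proof -
  let ?P = "\<Sum>i\<in>UNIV. entropy_term ((real (m i))\<^sup>2) ((torus_radii l \<beta> z i)\<^sup>2)"
  let ?Q = "entropy_term (\<Sum>i\<in>UNIV. (real (m i))\<^sup>2) (\<Sum>i\<in>UNIV. (torus_radii l \<beta> z i)\<^sup>2)"
  have v1: "1 \<le> torus_radii l \<beta> z i" for i using v(1)[of i] m[of i] by linarith
  have v_nz: "torus_radii l \<beta> z i \<noteq> 0" for i using v1[of i] by simp
  have z: "z $ i \<noteq> 0" for i using v1[of i] by (auto simp: torus_radii_def)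
  have "0 \<le> ?Q"
    using m v_nz by (intro entropy_term_nonneg sum_pos) auto
  then have "0 \<le> (1 - 1 / l) / 2 * ?Q" using l by simp
  moreover have "?P \<le> (\<Sum>i\<in>(UNIV :: 'n set). 4)"
    using m v v1 by (intro sum_mono entropy_term_le) auto
  then have "?P \<le> 4 * real CARD('n)" by simp
  ultimately have "- 2 * real CARD('n) \<le> (1 - 1 / l) / 2 * ?Q - ?P / 2" by linarith
  moreover have "norm (normalized_monom l \<beta> m z) * exp (- (\<beta> / 2) * norm z powr (2 * l)) =
      exp ((1 - 1 / l) / 2 * ?Q - ?P / 2)"
    by (rule normalized_monom_weighted[OF l \<beta>]) (use m z in auto)
  ultimately show ?thesis by (simp only: exp_le_cancel_iff)
qed

subsection \<open>Random polynomials\<close>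

text \<open>A single dyadic block of centres, so that the polynomial weight has one order of
  magnitude on all of them.\<close>

definition exponent_box :: "nat \<Rightarrow> ('n::finite \<Rightarrow> nat) set" where
  "exponent_box J = {m. \<forall>i. m i \<in> {J..2 * J}}"

lemma exponent_box_eq_PiE: "exponent_box J = PiE UNIV (\<lambda>_. {J..2 * J})"
  by (auto simp: exponent_box_def PiE_def extensional_def)

lemma finite_exponent_box [simp]: "finite (exponent_box J)"
  unfolding exponent_box_eq_PiE by (intro finite_PiE) auto

text \<open>The vector of radii has norm sqrt (\<beta> l) |z|^l, hence the exponent \<sigma>/l. The
  constant D absorbs sqrt (\<beta> l) or its inverse, together with the comparison of (1 + |z|)^l
  and 1 + |z|^l. Afterwards the weight can be shifted in the coordinates where the Gaussians
  live.\<close>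

lemma one_plus_norm_powr_le_radii:
  fixes \<sigma> :: real
  assumes l: "1 \<le> l" and \<beta>: "0 < \<beta>"
  obtains A where "0 < A" "\<And>z :: complex ^ 'n.
    (1 + norm z) powr \<sigma> \<le> A * (1 + norm (\<chi> i. torus_radii l \<beta> z i)) powr (\<sigma> / l)"
proof -
  let ?b = "sqrt (\<beta> * l)"
  define D where "D = max 1 (max ?b (1 / ?b)) * 2 powr l"
  have b: "0 < ?b" using l \<beta> by simp
  have two: "1 \<le> 2 powr l" "2 \<le> 2 powr l"
    using l powr_mono[of 1 l 2] by (auto simp: ge_one_powr_ge_zero)
  have D1: "1 \<le> D"
    unfolding D_def using two(1) mult_mono[of 1 "max 1 (max ?b (1 / ?b))" 1 "2 powr l"] by simp
  show ?thesis
  proof (rule that[of "D powr \<bar>\<sigma> / l\<bar>"])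
    fix z :: "complex ^ 'n"
    let ?v = "norm (\<chi> i. torus_radii l \<beta> z i)"
    let ?t = "norm z powr l"
    have "?v = sqrt (\<beta> * l * norm z powr (2 * l))"
      using l \<beta> by (simp add: norm_vec_def L2_set_def sum_torus_radii)
    also have "\<dots> = ?b * ?t"
      using l \<beta> by (simp add: real_sqrt_mult flip: powr_square)
    finally have v: "?v = ?b * ?t" .
    have t: "?t \<le> (1 + norm z) powr l" using l by (intro powr_mono2) auto
    have o: "1 \<le> (1 + norm z) powr l" using l by (simp add: ge_one_powr_ge_zero)
    have "(1 + norm z) powr l \<le> (2 * max 1 (norm z)) powr l"
      using l by (intro powr_mono2) auto
    also have "\<dots> = 2 powr l * (max 1 (norm z)) powr l" by (simp add: powr_mult)
    also have "(max 1 (norm z)) powr l \<le> 1 + ?t" by (simp add: max_def)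
    finally have u: "(1 + norm z) powr l \<le> 2 powr l * (1 + ?t)" by simp
    have "1 + ?t \<le> max 1 (max ?b (1 / ?b)) * (1 + ?v)"
    proof -
      have "?t = 1 / ?b * ?v"
        unfolding v by (simp only: times_divide_eq_left mult_1 nonzero_mult_div_cancel_left[OF less_imp_neq[OF b, symmetric]])
      also have "\<dots> \<le> max 1 (max ?b (1 / ?b)) * ?v" by (intro mult_right_mono) auto
      finally show ?thesis by (simp add: distrib_left)
    qed
    then have "2 powr l * (1 + ?t) \<le> 2 powr l * (max 1 (max ?b (1 / ?b)) * (1 + ?v))"
      by (intro mult_left_mono) auto
    also have "\<dots> = D * (1 + ?v)" by (simp only: D_def mult_ac)
    finally have 1: "(1 + norm z) powr l \<le> D * (1 + ?v)" by (rule order_trans[OF u])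
    have "1 + ?v \<le> max 1 (max ?b (1 / ?b)) * (1 + ?t)"
    proof -
      have "?v \<le> max 1 (max ?b (1 / ?b)) * ?t" unfolding v by (intro mult_right_mono) auto
      then show ?thesis by (simp add: distrib_left)
    qed
    also have "\<dots> \<le> max 1 (max ?b (1 / ?b)) * (2 powr l * (1 + norm z) powr l)"
    proof (intro mult_left_mono)
      have "1 + ?t \<le> 2 * (1 + norm z) powr l" using t o by simp
      also have "\<dots> \<le> 2 powr l * (1 + norm z) powr l" using two by (intro mult_right_mono) auto
      finally show "1 + ?t \<le> 2 powr l * (1 + norm z) powr l" .
    qed auto
    finally have 2: "1 + ?v \<le> D * (1 + norm z) powr l" by (simp add: D_def mult_ac)
    have "((1 + norm z) powr l) powr (\<sigma> / l) \<le> D powr \<bar>\<sigma> / l\<bar> * (1 + ?v) powr (\<sigma> / l)"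
    proof (rule powr_comparable[OF 1 2 D1])
      show "0 < (1 + norm z) powr l" using o by linarith
    qed (simp add: add_pos_nonneg)
    then show "(1 + norm z) powr \<sigma> \<le> D powr \<bar>\<sigma> / l\<bar> * (1 + ?v) powr (\<sigma> / l)"
      using l by (simp add: powr_powr)
  qed (use D1 in simp)
qed

text \<open>The triangle inequality suffices, because Gaussians of fixed width at lattice points
  have a bounded sum. The bound sums over the whole box, which factors into one-dimensional sums,
  and so covers every subset S at once.\<close>

lemma spread_sup_upper:
  fixes \<sigma> :: real
  assumes l: "1 \<le> l" and \<beta>: "0 < \<beta>"
  obtains C where "0 \<le> C" "\<And>(J :: nat) S z. 1 \<le> J \<Longrightarrow> S \<subseteq> exponent_box J \<Longrightarrow>
    weighted_abs l \<beta> \<sigma> (\<lambda>z :: complex ^ 'n. \<Sum>m\<in>S. normalized_monom l \<beta> m z) z \<le> C * real J powr (\<sigma> / l)"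
proof -
  let ?s = "\<sigma> / l"
  let ?vec = "\<lambda>z :: complex ^ 'n. \<chi> i. torus_radii l \<beta> z i"
  obtain A where A: "0 < A" "\<And>z :: complex ^ 'n. (1 + norm z) powr \<sigma> \<le> A * (1 + norm (?vec z)) powr ?s"
    using one_plus_norm_powr_le_radii[OF l \<beta>, of \<sigma>] by blast
  obtain G where G: "0 < G" "\<And>t. 0 \<le> t \<Longrightarrow> (1 + t) powr \<bar>?s\<bar> * exp (- (1 / (4 * l)) * t\<^sup>2) \<le> G"
    using gaussian_times_powr_bounded[of "1 / (4 * l)" "\<bar>?s\<bar>"] l by auto
  obtain B where B: "0 < B" "\<And>F v. finite F \<Longrightarrow> (0 :: real) \<le> v \<Longrightarrow> (\<Sum>j\<in>F. exp (- (1 / (4 * l)) * (real j - v)\<^sup>2)) \<le> B"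
    using sum_gaussian_bounded[of "1 / (4 * l)"] l by auto
  let ?E = "(1 + 2 * real CARD('n)) powr \<bar>?s\<bar>"
  show ?thesis
  proof (rule that[of "A * ?E * G * B ^ CARD('n)"])
    show "0 \<le> A * ?E * G * B ^ CARD('n)" using A(1) G(1) B(1) by simp
    fix J :: nat and S :: "('n \<Rightarrow> nat) set" and z :: "complex ^ 'n" assume J: "1 \<le> J" and S: "S \<subseteq> exponent_box J"
    let ?g = "\<lambda>m :: 'n \<Rightarrow> nat. \<Prod>i\<in>UNIV. exp (- (1 / (4 * l)) * (real (m i) - torus_radii l \<beta> z i)\<^sup>2)"
    have single: "(1 + norm z) powr \<sigma> * (norm (normalized_monom l \<beta> m z) * exp (- (\<beta> / 2) * norm z powr (2 * l)))
        \<le> (A * ?E * G * real J powr ?s) * ?g m" if m: "m \<in> exponent_box J" for m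
    proof -
      let ?a = "\<chi> i. real (m i)"
      define t where "t = norm (?a - ?vec z)"
      have mi: "J \<le> m i" "m i \<le> 2 * J" for i using m by (auto simp: exponent_box_def)
      have t2: "(\<Sum>i\<in>UNIV. (real (m i) - torus_radii l \<beta> z i)\<^sup>2) = t\<^sup>2"
        by (simp add: t_def norm_vec_def L2_set_def sum_nonneg)
      have "norm ?a \<le> (\<Sum>i\<in>UNIV. norm (?a $ i))" by (rule norm_le_l1_cart[unfolded real_norm_def[symmetric]])
      also have "\<dots> \<le> (\<Sum>i\<in>(UNIV :: 'n set). 2 * real J)"
        using mi(2) by (intro sum_mono) (simp add: of_nat_le_iff[symmetric, where 'a = real] del: of_nat_le_iff)
      finally have a_le: "1 + norm ?a \<le> (1 + 2 * real CARD('n)) * real J"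
        using J by (simp add: algebra_simps)
      \<comment> \<open>Any one coordinate bounds the norm from below; \<open>undefined\<close> is
        just some index.\<close>
      have "real J \<le> norm (?a $ undefined)" using mi(1) by simp
      also have "\<dots> \<le> norm ?a" unfolding real_norm_def by (rule component_le_norm_cart)
      also have "\<dots> \<le> 1 * (1 + norm ?a)" by simp
      also have "\<dots> \<le> (1 + 2 * real CARD('n)) * (1 + norm ?a)" by (intro mult_right_mono) auto
      finally have a_ge: "real J \<le> (1 + 2 * real CARD('n)) * (1 + norm ?a)" .
      have "(1 + norm (?vec z)) powr ?s \<le> (1 + norm ?a) powr ?s * (1 + t) powr \<bar>?s\<bar>"
        using one_plus_norm_powr_le[of "?vec z" ?s ?a] by (simp add: t_def norm_minus_commute)
      also have "\<dots> \<le> (?E * real J powr ?s) * (1 + t) powr \<bar>?s\<bar>"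
        using a_le a_ge J by (intro mult_right_mono powr_comparable) (auto simp: add_pos_nonneg)
      finally have "A * (1 + norm (?vec z)) powr ?s \<le> A * ((?E * real J powr ?s) * (1 + t) powr \<bar>?s\<bar>)"
        using A(1) by (intro mult_left_mono) auto
      with A(2)[of z] have 1: "(1 + norm z) powr \<sigma> \<le> (A * ?E * real J powr ?s) * (1 + t) powr \<bar>?s\<bar>"
        by (simp add: mult.assoc)
      have "0 < m i" for i using mi(1)[of i] J by linarith
      then have 2: "norm (normalized_monom l \<beta> m z) * exp (- (\<beta> / 2) * norm z powr (2 * l)) \<le> exp (- t\<^sup>2 / (2 * l))"
        using normalized_monom_weighted_le[OF l \<beta>, of m z] unfolding t2 by simp
      have "(1 + norm z) powr \<sigma> * (norm (normalized_monom l \<beta> m z) * exp (- (\<beta> / 2) * norm z powr (2 * l)))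
          \<le> ((A * ?E * real J powr ?s) * (1 + t) powr \<bar>?s\<bar>) * exp (- t\<^sup>2 / (2 * l))"
        using A(1) by (intro mult_mono 1 2) auto
      \<comment> \<open>One half of the exponent absorbs the cost of moving the weight to the centre
        m, the other half is kept for the summation.\<close>
      also have "exp (- t\<^sup>2 / (2 * l)) = exp (- (1 / (4 * l)) * t\<^sup>2) * exp (- (1 / (4 * l)) * t\<^sup>2)"
        using l by (simp add: field_simps flip: exp_add)
      also have "((A * ?E * real J powr ?s) * (1 + t) powr \<bar>?s\<bar>) * (exp (- (1 / (4 * l)) * t\<^sup>2) * exp (- (1 / (4 * l)) * t\<^sup>2))
          = (A * ?E * real J powr ?s) * ((1 + t) powr \<bar>?s\<bar> * exp (- (1 / (4 * l)) * t\<^sup>2)) * exp (- (1 / (4 * l)) * t\<^sup>2)"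
        by (simp only: mult_ac)
      also have "\<dots> \<le> (A * ?E * real J powr ?s) * G * exp (- (1 / (4 * l)) * t\<^sup>2)"
        using A(1) G(2)[of t] by (intro mult_right_mono mult_left_mono) (auto simp: t_def)
      also have "exp (- (1 / (4 * l)) * t\<^sup>2) = ?g m"
        by (simp only: t2[symmetric] sum_distrib_left exp_sum[OF finite])
      finally show ?thesis by (simp only: mult_ac)
    qed
    have "weighted_abs l \<beta> \<sigma> (\<lambda>z. \<Sum>m\<in>S. normalized_monom l \<beta> m z) z =
        norm (\<Sum>m\<in>S. normalized_monom l \<beta> m z) * ((1 + norm z) powr \<sigma> * exp (- (\<beta> / 2) * norm z powr (2 * l)))"
      by (simp add: weighted_abs_def mult_ac)
    also have "\<dots> \<le> (\<Sum>m\<in>S. norm (normalized_monom l \<beta> m z)) * ((1 + norm z) powr \<sigma> * exp (- (\<beta> / 2) * norm z powr (2 * l)))"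
      by (intro mult_right_mono norm_sum) auto
    also have "\<dots> = (\<Sum>m\<in>S. (1 + norm z) powr \<sigma> * (norm (normalized_monom l \<beta> m z) * exp (- (\<beta> / 2) * norm z powr (2 * l))))"
      unfolding sum_distrib_right by (simp only: mult_ac)
    also have "\<dots> \<le> (\<Sum>m\<in>S. (A * ?E * G * real J powr ?s) * ?g m)"
      using S by (intro sum_mono single) auto
    also have "\<dots> \<le> (\<Sum>m\<in>exponent_box J. (A * ?E * G * real J powr ?s) * ?g m)"
      using S A(1) G(1) by (intro sum_mono2) (auto intro!: mult_nonneg_nonneg prod_nonneg)
    also have "\<dots> = (A * ?E * G * real J powr ?s) * (\<Sum>m\<in>exponent_box J. ?g m)"
      by (simp only: sum_distrib_left)
    also have "(\<Sum>m\<in>exponent_box J. ?g m) =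
        (\<Prod>i\<in>UNIV. \<Sum>j\<in>{J..2 * J}. exp (- (1 / (4 * l)) * (real j - torus_radii l \<beta> z i)\<^sup>2))"
      unfolding exponent_box_eq_PiE by (rule prod_sum_PiE[symmetric]) auto
    also have "(A * ?E * G * real J powr ?s) * \<dots> \<le> (A * ?E * G * real J powr ?s) * (\<Prod>i\<in>(UNIV :: 'n set). B)"
      using l \<beta> A(1) G(1) by (intro mult_left_mono prod_mono conjI B(2) sum_nonneg) auto
    also have "\<dots> = A * ?E * G * B ^ CARD('n) * real J powr ?s"
      by (simp only: prod_constant mult_ac)
    finally show "weighted_abs l \<beta> \<sigma> (\<lambda>z. \<Sum>m\<in>S. normalized_monom l \<beta> m z) z
        \<le> A * ?E * G * B ^ CARD('n) * real J powr ?s" .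
  qed
qed

text \<open>Toggling the membership of \<open>a\<close> in \<open>S\<close> changes the sum by \<open>b a\<close>, so that one of the
  two sums has modulus at least \<open>norm (b a) / 2\<close>.\<close>

lemma sum_Pow_norm_powr_ge:
  fixes b :: "'a \<Rightarrow> 'b::real_normed_vector"
  assumes A: "finite A" "a \<in> A" and r: "0 \<le> r"
  shows "2 ^ card A * ((norm (b a) / 2) powr r / 2) \<le> (\<Sum>S\<in>Pow A. norm (\<Sum>x\<in>S. b x) powr r)"
proof -
  define A' where "A' = A - {a}"
  have A': "finite A'" "a \<notin> A'" "A = insert a A'" using A by (auto simp: A'_def)
  let ?F = "\<lambda>S. norm (\<Sum>x\<in>S. b x) powr r"
  have pair: "(norm (b a) / 2) powr r \<le> ?F S + ?F (insert a S)" if S: "S \<in> Pow A'" for S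
  proof -
    have "a \<notin> S" "finite S" using S A' finite_subset by auto
    then have "norm (b a) = norm ((\<Sum>x\<in>insert a S. b x) - (\<Sum>x\<in>S. b x))" by simp
    also have "\<dots> \<le> norm (\<Sum>x\<in>insert a S. b x) + norm (\<Sum>x\<in>S. b x)" by (rule norm_triangle_ineq4)
    finally consider "norm (b a) / 2 \<le> norm (\<Sum>x\<in>S. b x)" | "norm (b a) / 2 \<le> norm (\<Sum>x\<in>insert a S. b x)"
      by linarith
    then show ?thesis
    proof cases
      case 1
      then have "(norm (b a) / 2) powr r \<le> ?F S" using r by (intro powr_mono2) auto
      then show ?thesis by (rule add_increasing2[rotated]) simp
    next
      case 2
      then have "(norm (b a) / 2) powr r \<le> ?F (insert a S)" using r by (intro powr_mono2) auto
      then show ?thesis by (rule add_increasing[rotated]) simp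
    qed
  qed
  have "2 ^ card A * ((norm (b a) / 2) powr r / 2) = (\<Sum>S\<in>Pow A'. (norm (b a) / 2) powr r)"
    using A' by (simp add: card_Pow)
  also have "\<dots> \<le> (\<Sum>S\<in>Pow A'. ?F S + ?F (insert a S))" by (intro sum_mono pair)
  also have "\<dots> = (\<Sum>S\<in>Pow A'. ?F S) + (\<Sum>S\<in>insert a ` Pow A'. ?F S)"
  proof -
    have "inj_on (insert a) (Pow A')" using A'(2) by (auto simp: inj_on_def)
    then show ?thesis by (simp add: sum.distrib sum.reindex)
  qed
  also have "\<dots> = (\<Sum>S\<in>Pow A. ?F S)"
    unfolding A'(3) Pow_insert using A' by (intro sum.union_disjoint[symmetric]) auto
  finally show ?thesis .
qed

text \<open>Each radius increases with both |z| and |z_i|, so confining all |z_i| to [s, \<kappa> s]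
  controls it by its values at two diagonal points. These are J and 2J, since the radii scale with
  degree l and \<open>\<kappa> powr l = 2\<close>. The ball around the midpoint stays in that range,
  and its radius is of order J^(1/l).\<close>

lemma spread_region:
  assumes l: "1 \<le> l" and \<beta>: "0 < \<beta>"
  obtains \<delta> A where "0 < \<delta>" "1 \<le> A" "\<And>J :: nat. 1 \<le> J \<Longrightarrow> \<exists>w :: complex ^ 'n.
    \<forall>z \<in> ball w (\<delta> * real J powr (1 / l)). (\<forall>i. real J \<le> torus_radii l \<beta> z i \<and> torus_radii l \<beta> z i \<le> 2 * real J) \<and>
      1 + norm z \<le> A * real J powr (1 / l) \<and> real J powr (1 / l) \<le> A * (1 + norm z)"
proof -
  let ?N = "sqrt (real CARD('n))"
  \<comment> \<open>At the point with all coordinates equal to s every radius is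
    \<open>b * s powr l\<close>; the number e is chosen so that s =
    \<open>e * real J powr (1 / l)\<close> gives J.\<close>
  define b where "b = sqrt (\<beta> * l) * ?N powr (l - 1)"
  define e where "e = b powr (- 1 / l)"
  define \<kappa> where "\<kappa> = 2 powr (1 / l)"
  have N: "1 \<le> ?N" by simp
  have b: "0 < b" using l \<beta> N unfolding b_def by (intro mult_pos_pos) auto
  have e: "0 < e" using b by (simp add: e_def)
  have \<kappa>: "1 < \<kappa>" "\<kappa> \<le> 2"
    using l powr_less_mono[of 0 "1 / l" 2] powr_mono[of "1 / l" 1 2] by (auto simp: \<kappa>_def)
  have \<kappa>l: "\<kappa> powr l = 2" using l by (simp add: \<kappa>_def powr_powr)
  show ?thesis
  proof (rule that[of "(\<kappa> - 1) / 2 * e" "1 + 2 * ?N * e + 1 / e"])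
    show "0 < (\<kappa> - 1) / 2 * e" using \<kappa> e by simp
    show "1 \<le> 1 + 2 * ?N * e + 1 / e" using e N by simp
    fix J :: nat assume J: "1 \<le> J"
    define x where "x = real J powr (1 / l)"
    define s where "s = e * x"
    have x: "1 \<le> x" using J l by (simp add: x_def ge_one_powr_ge_zero)
    have s: "0 < s" using e x by (simp add: s_def)
    have "s powr l = e powr l * x powr l" unfolding s_def by (rule powr_mult)
    also have "e powr l = 1 / b" unfolding e_def powr_powr using l b by (simp add: powr_minus_divide)
    also have "x powr l = real J" using l J by (simp add: x_def powr_powr)
    finally have bs: "b * s powr l = real J" using b by simp
    have sl: "s powr (l - 1) * s = s powr l" using s by (simp add: powr_diff)
    define w :: "complex ^ 'n" where "w = (\<chi> i. of_real ((1 + \<kappa>) / 2 * s))"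
    show "\<exists>w :: complex ^ 'n. \<forall>z \<in> ball w ((\<kappa> - 1) / 2 * e * real J powr (1 / l)).
        (\<forall>i. real J \<le> torus_radii l \<beta> z i \<and> torus_radii l \<beta> z i \<le> 2 * real J) \<and>
        1 + norm z \<le> (1 + 2 * ?N * e + 1 / e) * real J powr (1 / l) \<and>
        real J powr (1 / l) \<le> (1 + 2 * ?N * e + 1 / e) * (1 + norm z)"
      unfolding x_def[symmetric]
    proof (intro exI[of _ w] ballI)
      fix z assume "z \<in> ball w ((\<kappa> - 1) / 2 * e * x)"
      then have d: "norm (z - w) < (\<kappa> - 1) / 2 * s" by (simp add: s_def dist_norm norm_minus_commute mult.assoc)
      have zi: "s \<le> norm (z $ i)" "norm (z $ i) \<le> \<kappa> * s" for i
      proof -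
        have "norm (z $ i - w $ i) \<le> norm (z - w)"
          using Finite_Cartesian_Product.norm_nth_le[of "z - w" i] by simp
        then have "norm (z $ i - w $ i) \<le> (\<kappa> - 1) / 2 * s" using d by simp
        moreover have "norm (w $ i) = (1 + \<kappa>) / 2 * s" unfolding w_def vec_lambda_beta norm_of_real using \<kappa> s by simp
        moreover have "\<bar>norm (z $ i) - norm (w $ i)\<bar> \<le> norm (z $ i - w $ i)" by (rule norm_triangle_ineq3)
        ultimately have "\<bar>norm (z $ i) - (1 + \<kappa>) / 2 * s\<bar> \<le> (\<kappa> - 1) / 2 * s" by linarith
        then show "s \<le> norm (z $ i)" "norm (z $ i) \<le> \<kappa> * s" by (auto simp: abs_le_iff field_simps)
      qed
      have "(\<Sum>i\<in>(UNIV :: 'n set). s\<^sup>2) \<le> (\<Sum>i\<in>UNIV. (norm (z $ i))\<^sup>2)"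
        using s zi(1) by (intro sum_mono power_mono) auto
      then have "sqrt (real CARD('n) * s\<^sup>2) \<le> norm z"
        unfolding norm_vec_def L2_set_def by (intro real_sqrt_le_mono) simp
      then have n1: "?N * s \<le> norm z" using s by (simp add: real_sqrt_mult)
      have "(\<Sum>i\<in>UNIV. (norm (z $ i))\<^sup>2) \<le> (\<Sum>i\<in>(UNIV :: 'n set). (\<kappa> * s)\<^sup>2)"
        using zi(2) by (intro sum_mono power_mono) auto
      then have "norm z \<le> sqrt (real CARD('n) * (\<kappa> * s)\<^sup>2)"
        unfolding norm_vec_def L2_set_def by (intro real_sqrt_le_mono) simp
      also have "\<dots> = ?N * (\<kappa> * s)" using s \<kappa> by (simp add: real_sqrt_mult)
      finally have n2: "norm z \<le> ?N * (\<kappa> * s)" .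
      have low: "real J \<le> torus_radii l \<beta> z i" for i
      proof -
        have "real J = sqrt (\<beta> * l) * (?N * s) powr (l - 1) * s"
          using s by (simp add: b_def powr_mult mult.assoc flip: bs sl)
        also have "\<dots> \<le> torus_radii l \<beta> z i"
          unfolding torus_radii_def using s n1 zi(1)[of i] l \<beta>
          by (intro mult_mono powr_mono2) auto
        finally show ?thesis .
      qed
      have up: "torus_radii l \<beta> z i \<le> 2 * real J" for i
      proof -
        have "torus_radii l \<beta> z i \<le> sqrt (\<beta> * l) * (?N * (\<kappa> * s)) powr (l - 1) * (\<kappa> * s)"
          unfolding torus_radii_def using s n2 zi(2)[of i] l \<beta> \<kappa>
          by (intro mult_mono powr_mono2) auto
        also have "\<dots> = b * ((\<kappa> * s) powr (l - 1) * (\<kappa> * s))"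
          using s \<kappa> by (simp add: b_def powr_mult mult_ac)
        also have "(\<kappa> * s) powr (l - 1) * (\<kappa> * s) = (\<kappa> * s) powr l"
          using s \<kappa> by (simp add: powr_diff)
        also have "b * (\<kappa> * s) powr l = \<kappa> powr l * (b * s powr l)" by (simp add: powr_mult)
        finally show ?thesis by (simp only: \<kappa>l bs)
      qed
      have "norm z \<le> ?N * (2 * s)" using n2 \<kappa> s N by (meson mult_left_mono mult_right_mono order_trans less_imp_le real_sqrt_ge_zero of_nat_0_le_iff)
      then have z_le: "norm z \<le> 2 * ?N * e * x" by (simp add: s_def mult_ac)
      have "0 \<le> 1 / e * x" using e x by simp
      then have up2: "1 + norm z \<le> (1 + 2 * ?N * e + 1 / e) * x"
        using z_le x by (simp add: distrib_right)
      have "s \<le> norm z" using n1 mult_right_mono[OF N, of s] s by linarith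
      then have "x \<le> 1 / e * norm z" using e by (simp add: s_def field_simps)
      also have "\<dots> \<le> (1 + 2 * ?N * e + 1 / e) * (1 + norm z)"
        using e by (intro mult_mono) auto
      finally show "(\<forall>i. real J \<le> torus_radii l \<beta> z i \<and> torus_radii l \<beta> z i \<le> 2 * real J) \<and>
        1 + norm z \<le> (1 + 2 * ?N * e + 1 / e) * x \<and> x \<le> (1 + 2 * ?N * e + 1 / e) * (1 + norm z)"
        using low up up2 by blast
    qed
  qed
qed

text \<open>Some subset of the box does at least as well as the average over all subsets.\<close>

lemma spread_norm_lower:
  fixes \<eta> r :: real
  assumes l: "1 \<le> l" and \<beta>: "0 < \<beta>" and r: "1 \<le> r"
  obtains c where "0 < c" "\<And>J :: nat. 1 \<le> J \<Longrightarrow> \<exists>S \<subseteq> exponent_box J.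
    ennreal (c * real J powr ((\<eta> * r + real (2 * CARD('n))) / l)) \<le>
    (\<integral>\<^sup>+z. ennreal (weighted_abs l \<beta> \<eta> (\<lambda>z :: complex ^ 'n. \<Sum>m\<in>S. normalized_monom l \<beta> m z) z powr r) \<partial>dV)"
proof -
  let ?d = "2 * CARD('n)"
  obtain \<delta> A where \<delta>: "0 < \<delta>" and A: "1 \<le> A" and region: "\<And>J :: nat. 1 \<le> J \<Longrightarrow> \<exists>w :: complex ^ 'n.
    \<forall>z \<in> ball w (\<delta> * real J powr (1 / l)). (\<forall>i. real J \<le> torus_radii l \<beta> z i \<and> torus_radii l \<beta> z i \<le> 2 * real J) \<and>
      1 + norm z \<le> A * real J powr (1 / l) \<and> real J powr (1 / l) \<le> A * (1 + norm z)"
    using spread_region[OF l \<beta>] by blast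
  \<comment> \<open>The exponential is the lower bound for the nearest monomial, the 2 is lost in
    toggling it, and the power of A in comparing 1 + norm z with
    \<open>J powr (1 / l)\<close>.\<close>
  define k where "k = exp (- 2 * real CARD('n)) / (2 * A powr \<bar>\<eta>\<bar>)"
  have k: "0 < k" using A by (simp add: k_def)
  show ?thesis
  proof (rule that[of "k powr r / 2 * \<delta> ^ ?d"])
    show "0 < k powr r / 2 * \<delta> ^ ?d" using k \<delta> by simp
    fix J :: nat assume J: "1 \<le> J"
    define x where "x = real J powr (1 / l)"
    have x: "1 \<le> x" using J l by (simp add: x_def ge_one_powr_ge_zero)
    obtain w :: "complex ^ 'n" where w: "\<And>z. z \<in> ball w (\<delta> * x) \<Longrightarrow>
      (\<forall>i. real J \<le> torus_radii l \<beta> z i \<and> torus_radii l \<beta> z i \<le> 2 * real J) \<and> 1 + norm z \<le> A * x \<and> x \<le> A * (1 + norm z)"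
      using region[OF J] unfolding x_def by blast
    let ?P = "Pow (exponent_box J :: ('n \<Rightarrow> nat) set)"
    let ?c = "card (exponent_box J :: ('n \<Rightarrow> nat) set)"
    define T where "T S = weighted_abs l \<beta> \<eta> (\<lambda>z :: complex ^ 'n. \<Sum>m\<in>S. normalized_monom l \<beta> m z)" for S
    have [measurable]: "T S \<in> borel_measurable borel" for S
      unfolding T_def by (intro weighted_abs_measurable entire_sum entire_normalized_monom)
    have pointwise: "2 ^ ?c * ((k * x powr \<eta>) powr r / 2) \<le> (\<Sum>S\<in>?P. T S z powr r)" if z: "z \<in> ball w (\<delta> * x)" for z
    proof -
      \<comment> \<open>The centre m varies with z, but the resulting bound for the sum over all
        subsets does not. Hence one subset, independent of z, can be chosen after
        integration.\<close>
      define m where "m i = nat \<lfloor>torus_radii l \<beta> z i\<rfloor>" for i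
      have v: "real J \<le> torus_radii l \<beta> z i" "torus_radii l \<beta> z i \<le> 2 * real J" for i using w[OF z] by auto
      have "J \<le> m i \<and> m i \<le> 2 * J \<and> 0 < m i \<and> real (m i) \<le> torus_radii l \<beta> z i \<and> torus_radii l \<beta> z i \<le> real (m i) + 1" for i
        using v[of i] J unfolding m_def by linarith
      then have m: "m \<in> exponent_box J" "\<And>i. 0 < m i" "\<And>i. real (m i) \<le> torus_radii l \<beta> z i" "\<And>i. torus_radii l \<beta> z i \<le> real (m i) + 1"
        by (auto simp: exponent_box_def)
      define W where "W = (1 + norm z) powr \<eta> * exp (- (\<beta> / 2) * norm z powr (2 * l))"
      have W: "0 \<le> W" by (simp add: W_def)
      have T: "T S z = norm (\<Sum>m\<in>S. normalized_monom l \<beta> m z) * W" for S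
        by (simp add: T_def weighted_abs_def W_def mult_ac)
      have "x powr \<eta> \<le> A powr \<bar>\<eta>\<bar> * (1 + norm z) powr \<eta>"
        using w[OF z] A x by (intro powr_comparable) (auto simp: add_pos_nonneg)
      then have 1: "x powr \<eta> / A powr \<bar>\<eta>\<bar> \<le> (1 + norm z) powr \<eta>" using A by (simp add: field_simps)
      have "k * x powr \<eta> = exp (- 2 * real CARD('n)) * (x powr \<eta> / A powr \<bar>\<eta>\<bar>) / 2" by (simp add: k_def)
      also have "\<dots> \<le> (norm (normalized_monom l \<beta> m z) * exp (- (\<beta> / 2) * norm z powr (2 * l))) * (1 + norm z) powr \<eta> / 2"
        by (intro divide_right_mono mult_mono 1 normalized_monom_weighted_ge[OF l \<beta> m(2-4)]) auto
      also have "\<dots> = norm (normalized_monom l \<beta> m z) / 2 * W" by (simp add: W_def)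
      finally have "(k * x powr \<eta>) powr r \<le> (norm (normalized_monom l \<beta> m z) / 2 * W) powr r"
        using k r by (intro powr_mono2) auto
      also have "\<dots> = (norm (normalized_monom l \<beta> m z) / 2) powr r * W powr r" by (rule powr_mult)
      finally have "2 ^ ?c * ((k * x powr \<eta>) powr r / 2) \<le> 2 ^ ?c * ((norm (normalized_monom l \<beta> m z) / 2) powr r * W powr r / 2)"
        by (intro mult_left_mono divide_right_mono) auto
      also have "\<dots> = (2 ^ ?c * ((norm (normalized_monom l \<beta> m z) / 2) powr r / 2)) * W powr r" by simp
      also have "\<dots> \<le> (\<Sum>S\<in>?P. norm (\<Sum>m\<in>S. normalized_monom l \<beta> m z) powr r) * W powr r"
        using m(1) r by (intro mult_right_mono sum_Pow_norm_powr_ge) auto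
      also have "\<dots> = (\<Sum>S\<in>?P. T S z powr r)"
        unfolding T sum_distrib_right by (intro sum.cong refl) (simp only: powr_mult)
      finally show ?thesis .
    qed
    let ?Y = "(k * x powr \<eta>) powr r / 2"
    let ?I = "\<lambda>S. \<integral>\<^sup>+z. ennreal (T S z powr r) \<partial>dV"
    let ?M = "Max (?I ` ?P)"
    have "ennreal (2 ^ ?c) * ennreal (?Y * (\<delta> * x) ^ ?d) = ennreal (2 ^ ?c * ?Y) * emeasure dV (ball w (\<delta> * x))"
      using \<delta> x by (simp add: emeasure_dV_ball mult.assoc flip: ennreal_mult')
    also have "\<dots> = (\<integral>\<^sup>+z. ennreal (2 ^ ?c * ?Y) * indicator (ball w (\<delta> * x)) z \<partial>dV)"
      by (subst nn_integral_cmult_indicator) auto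
    also have "\<dots> \<le> (\<integral>\<^sup>+z. (\<Sum>S\<in>?P. ennreal (T S z powr r)) \<partial>dV)"
    proof (intro nn_integral_mono)
      fix z
      show "ennreal (2 ^ ?c * ?Y) * indicator (ball w (\<delta> * x)) z \<le> (\<Sum>S\<in>?P. ennreal (T S z powr r))"
        using pointwise[of z] by (cases "z \<in> ball w (\<delta> * x)") (auto simp: sum_ennreal intro!: ennreal_leI)
    qed
    also have "\<dots> = (\<Sum>S\<in>?P. ?I S)" by (rule nn_integral_sum) simp
    also have "\<dots> \<le> of_nat (card ?P) * ?M" by (intro sum_bounded_above Max_ge) auto
    also have "of_nat (card ?P) = ennreal (2 ^ ?c)" by (simp add: card_Pow ennreal_of_nat_eq_real_of_nat)
    finally have le: "ennreal (?Y * (\<delta> * x) ^ ?d) \<le> ?M"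
      by (subst (asm) ennreal_mult_le_mult_iff) auto
    have "?M \<in> ?I ` ?P" by (intro Max_in) auto
    then obtain S where S: "S \<subseteq> exponent_box J" "?M = ?I S" by auto
    have "?Y * (\<delta> * x) ^ ?d = k powr r / 2 * \<delta> ^ ?d * (x powr (\<eta> * r) * x powr real ?d)"
      using k x by (simp add: powr_mult powr_powr power_mult_distrib powr_realpow del: of_nat_mult)
    also have "x powr (\<eta> * r) * x powr real ?d = real J powr ((\<eta> * r + real ?d) / l)"
      by (simp add: x_def powr_powr add_divide_distrib flip: powr_add)
    finally have "ennreal (k powr r / 2 * \<delta> ^ ?d * real J powr ((\<eta> * r + real ?d) / l)) \<le> ?I S"
      using le S(2) by simp
    then show "\<exists>S \<subseteq> exponent_box J. ennreal (k powr r / 2 * \<delta> ^ ?d * real J powr ((\<eta> * r + real ?d) / l)) \<le>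
        (\<integral>\<^sup>+z. ennreal (weighted_abs l \<beta> \<eta> (\<lambda>z :: complex ^ 'n. \<Sum>m\<in>S. normalized_monom l \<beta> m z) z powr r) \<partial>dV)"
      using S(1) unfolding T_def by blast
  qed
qed

text \<open>For finite p the quotient of the two weights is p-integrable because (\<sigma> - \<rho>)
  p exceeds the real dimension, which is where the strict inequality enters; for p = infinity it is
  bounded by 1.\<close>

lemma fock_norm_le_sup:
  fixes \<rho> \<sigma> :: real
  assumes p: "1 \<le> p" and \<sigma>: "\<rho> + real (2 * CARD('n)) / enn2real p < \<sigma>"
  obtains D where "0 \<le> D" "\<And>(f :: complex ^ 'n \<Rightarrow> complex) K. entire f \<Longrightarrow> 0 \<le> K \<Longrightarrow>
    (\<And>z. weighted_abs l \<beta> \<sigma> f z \<le> K) \<Longrightarrow> f \<in> fock_space l \<beta> \<rho> p \<and> fock_norm l \<beta> \<rho> p f \<le> K * D"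
proof -
  define h where "h z = (1 + norm z) powr (\<rho> - \<sigma>)" for z :: "complex ^ 'n"
  have split: "weighted_abs l \<beta> \<rho> f z = weighted_abs l \<beta> \<sigma> f z * h z" for f z
  proof -
    have "(1 + norm z) powr \<rho> = (1 + norm z) powr \<sigma> * h z" by (simp add: h_def flip: powr_add)
    then show ?thesis by (simp add: weighted_abs_def mult_ac)
  qed
  have pointwise: "weighted_abs l \<beta> \<rho> f z \<le> K * h z" if "weighted_abs l \<beta> \<sigma> f z \<le> K" for f z K
    unfolding split using that by (intro mult_right_mono) (auto simp: h_def)
  have "0 \<le> real (2 * CARD('n)) / enn2real p" by simp
  then have \<rho>\<sigma>: "\<rho> - \<sigma> \<le> 0" using \<sigma> by linarith
  have h: "0 \<le> h z" "h z \<le> 1" for z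
    using powr_mono2'[OF \<rho>\<sigma>, of 1 "1 + norm z"] by (auto simp: h_def)
  have hm: "h \<in> borel_measurable borel" unfolding h_def by measurable
  show ?thesis
    using p
  proof (cases rule: exponent_cases)
    case top
    show ?thesis
    proof (rule that[of 1])
      fix f :: "complex ^ 'n \<Rightarrow> complex" and K :: real
      assume f: "entire f" and K: "0 \<le> K" "\<And>z. weighted_abs l \<beta> \<sigma> f z \<le> K"
      have le: "weighted_abs l \<beta> \<rho> f z \<le> K * 1" for z
        using order_trans[OF pointwise[OF K(2)] mult_left_mono[OF h(2) K(1)]] .
      show "f \<in> fock_space l \<beta> \<rho> p \<and> fock_norm l \<beta> \<rho> p f \<le> K * 1"
        unfolding top using f le by (auto simp del: fock_norm_top intro!: fock_norm_top_leI bdd_aboveI2)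
    qed simp
  next
    case (real r)
    define I where "I = enn2real (\<integral>\<^sup>+z. ennreal (h z powr r) \<partial>dV)"
    have "real (2 * CARD('n)) < (\<sigma> - \<rho>) * r"
      using \<sigma> real by (simp add: field_simps)
    from nn_integral_one_plus_norm_powr_finite[OF this]
    have fin: "(\<integral>\<^sup>+z. ennreal (h z powr r) \<partial>dV) < \<infinity>"
      by (simp only: h_def powr_powr minus_mult_left minus_diff_eq)
    have "(\<integral>\<^sup>+z. ennreal (h z powr r) \<partial>dV) = ennreal ((I powr (1 / r)) powr r)"
      using fin real(2) by (simp add: I_def powr_powr)
    from fock_norm_le_of_pointwise_powr[OF real(2) _ _ pointwise h(1) hm eq_refl[OF this]]
    show ?thesis
      unfolding real(1)[symmetric] by (intro that[of "I powr (1 / r)"]) auto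
  qed
qed

text \<open>The spread functions have \<sigma>-weighted supremum of order at most J^(\<sigma>/l),
  while the r-th power of their target norm is at least of order J^((\<eta> r + 2n)/l). Comparing
  growth bounds \<eta> + 2n/r by \<sigma>, and \<sigma> may be taken arbitrarily close to \<rho> +
  2n/p.\<close>

lemma fock_embeds_spread_exponents:
  assumes l: "1 \<le> l" and \<beta>: "0 < \<beta>" and p: "1 \<le> p" and r: "1 \<le> r"
    and emb: "fock_embeds TYPE('n::finite) l \<beta> \<rho> p \<eta> (ennreal r)"
  shows "\<eta> + real (2 * CARD('n)) / r \<le> \<rho> + real (2 * CARD('n)) / enn2real p"
proof (rule field_le_epsilon)
  fix e :: real assume e: "0 < e"
  let ?d = "real (2 * CARD('n))"
  define \<sigma> where "\<sigma> = \<rho> + ?d / enn2real p + e"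
  have q: "1 \<le> ennreal r" using r by (simp flip: ennreal_1)
  let ?f = "\<lambda>S z. \<Sum>m\<in>S. normalized_monom l \<beta> m (z :: complex ^ 'n)"
  have entire: "entire (?f S)" for S by (intro entire_sum entire_normalized_monom)
  obtain C where C: "0 \<le> C" "\<And>(J :: nat) S z. 1 \<le> J \<Longrightarrow> S \<subseteq> exponent_box J \<Longrightarrow>
    weighted_abs l \<beta> \<sigma> (?f S) z \<le> C * real J powr (\<sigma> / l)"
    using spread_sup_upper[OF l \<beta>, of \<sigma>] by blast
  obtain D where D: "0 \<le> D" "\<And>(f :: complex ^ 'n \<Rightarrow> complex) K. entire f \<Longrightarrow> 0 \<le> K \<Longrightarrow>
    (\<And>z. weighted_abs l \<beta> \<sigma> f z \<le> K) \<Longrightarrow> f \<in> fock_space l \<beta> \<rho> p \<and> fock_norm l \<beta> \<rho> p f \<le> K * D"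
  proof -
    have "\<rho> + ?d / enn2real p < \<sigma>" using e by (simp add: \<sigma>_def)
    then show ?thesis using fock_norm_le_sup[OF p] that by blast
  qed
  obtain c where c: "0 < c" "\<And>J :: nat. 1 \<le> J \<Longrightarrow> \<exists>S \<subseteq> exponent_box J.
    ennreal (c * real J powr ((\<eta> * r + ?d) / l)) \<le> (\<integral>\<^sup>+z. ennreal (weighted_abs l \<beta> \<eta> (?f S) z powr r) \<partial>dV)"
    using spread_norm_lower[OF l \<beta> r, of \<eta>] by blast
  obtain K where sub: "fock_space l \<beta> \<rho> p \<subseteq> (fock_space l \<beta> \<eta> (ennreal r) :: (complex ^ 'n \<Rightarrow> complex) set)"
    and K: "\<And>f :: complex ^ 'n \<Rightarrow> complex. f \<in> fock_space l \<beta> \<rho> p \<Longrightarrow> fock_norm l \<beta> \<eta> (ennreal r) f \<le> K * fock_norm l \<beta> \<rho> p f"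
    using emb unfolding fock_embeds_def embeds_def by blast
  have "(\<eta> * r + ?d) / l \<le> \<sigma> / l * r"
  proof (rule powr_le_imp_exponent_le[OF c(1)])
    fix J :: nat assume J: "1 \<le> J"
    obtain S where S: "S \<subseteq> exponent_box J" and
      low: "ennreal (c * real J powr ((\<eta> * r + ?d) / l)) \<le> (\<integral>\<^sup>+z. ennreal (weighted_abs l \<beta> \<eta> (?f S) z powr r) \<partial>dV)"
      using c(2)[OF J] by blast
    let ?x = "real J powr (\<sigma> / l)"
    have f: "?f S \<in> fock_space l \<beta> \<rho> p" "fock_norm l \<beta> \<rho> p (?f S) \<le> C * ?x * D"
      using D(2)[of "?f S" "C * ?x"] C(2)[OF J S] C(1) entire by auto
    have fq: "?f S \<in> fock_space l \<beta> \<eta> (ennreal r)" using f(1) sub by blast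
    have "fock_norm l \<beta> \<eta> (ennreal r) (?f S) \<le> K * fock_norm l \<beta> \<rho> p (?f S)" by (rule K[OF f(1)])
    also have "\<dots> \<le> \<bar>K\<bar> * fock_norm l \<beta> \<rho> p (?f S)"
      using fock_norm_nonneg[OF p f(1)] by (intro mult_right_mono) auto
    also have "\<dots> \<le> \<bar>K\<bar> * (C * ?x * D)" using f(2) by (intro mult_left_mono) auto
    finally have "fock_norm l \<beta> \<eta> (ennreal r) (?f S) powr r \<le> (\<bar>K\<bar> * (C * ?x * D)) powr r"
      using r fock_norm_nonneg[OF q fq] by (intro powr_mono2) auto
    moreover have "ennreal (c * real J powr ((\<eta> * r + ?d) / l)) \<le> ennreal (fock_norm l \<beta> \<eta> (ennreal r) (?f S) powr r)"
      using low fock_norm_powr[OF r fq] by simp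
    then have "c * real J powr ((\<eta> * r + ?d) / l) \<le> fock_norm l \<beta> \<eta> (ennreal r) (?f S) powr r"
      by (simp add: ennreal_le_iff)
    ultimately have "c * real J powr ((\<eta> * r + ?d) / l) \<le> (\<bar>K\<bar> * C * D * ?x) powr r" by (simp add: mult_ac)
    also have "\<dots> = (\<bar>K\<bar> * C * D) powr r * real J powr (\<sigma> / l * r)"
      by (simp add: powr_mult powr_powr)
    finally show "c * real J powr ((\<eta> * r + ?d) / l) \<le> (\<bar>K\<bar> * C * D) powr r * real J powr (\<sigma> / l * r)" .
  qed
  then have "(\<eta> * r + ?d) / l \<le> (\<sigma> * r) / l" by simp
  then have "\<eta> * r + ?d \<le> \<sigma> * r" using l by (subst (asm) divide_le_cancel) auto
  then have "\<eta> + ?d / r \<le> \<sigma>" using r by (simp add: field_simps)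
  then show "\<eta> + ?d / r \<le> \<rho> + ?d / enn2real p + e" by (simp add: \<sigma>_def)
qed

text \<open>The convention 1/0 = 0 keeps the reciprocal strictly decreasing up to and including
  infinity.\<close>

lemma one_over_enn2real_less:
  assumes "1 \<le> p" "p < (q :: ennreal)"
  shows "1 / enn2real q < 1 / enn2real p"
  using assms(1)
proof (cases rule: exponent_cases)
  case (real r)
  have "1 \<le> q" using assms by simp
  then show ?thesis
  proof (cases rule: exponent_cases)
    case (real s)
    then have "r < s" using assms(2) \<open>p = ennreal r\<close> \<open>1 \<le> r\<close> by (simp add: ennreal_less_iff)
    then show ?thesis using real \<open>p = ennreal r\<close> \<open>1 \<le> r\<close> by (simp add: frac_less2)
  qed (use real in simp)
qed (use assms in simp)

text \<open>As q < p forces q to be finite, the spread functions apply. The strict conclusion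
  excludes q < p altogether when the two weights agree.\<close>

lemma fock_embeds_weights_less:
  assumes "1 \<le> l" "0 < \<beta>" "1 \<le> q" "q < p" "fock_embeds TYPE('n::finite) l \<beta> \<rho> p \<eta> q"
  shows "\<eta> < \<rho>"
  using \<open>1 \<le> q\<close>
proof (cases rule: exponent_cases)
  case (real r)
  have "1 \<le> p" using assms by simp
  have "1 / enn2real p < 1 / r"
    using one_over_enn2real_less[OF assms(3,4)] real by simp
  then have "real (2 * CARD('n)) * (1 / enn2real p) < real (2 * CARD('n)) * (1 / r)"
    by (intro mult_strict_left_mono) auto
  then show ?thesis
    using fock_embeds_spread_exponents[OF assms(1,2) \<open>1 \<le> p\<close> real(2), of \<rho> \<eta>, where 'n = 'n] assms(5) real(1) by simp
qed (use assms in simp)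

theorem corollary1p4:
  fixes \<beta> \<rho> \<eta> :: real and p q :: ennreal
  assumes "\<beta> > 0" and "1 \<le> p" and "1 \<le> q"
  shows "(\<forall>l\<ge>1. fock_embeds TYPE('n::finite) l \<beta> \<rho> p \<eta> q \<longrightarrow> \<rho> \<ge> \<eta>)
       \<and> (fock_embeds TYPE('n) 1 \<beta> \<rho> p \<rho> q \<longleftrightarrow> p \<le> q)
       \<and> (\<forall>l>1. fock_embeds TYPE('n) l \<beta> \<rho> p \<rho> q \<longleftrightarrow> p = q)"
proof (intro conjI allI impI)
  have inv_less: "1 / enn2real q < 1 / enn2real p" if "p < q"
    using one_over_enn2real_less[OF assms(2) that] .
  have pq: "p \<le> q" if "1 \<le> l" "fock_embeds TYPE('n) l \<beta> \<rho> p \<rho> q" for l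
    using fock_embeds_weights_less[OF that(1) assms(1,3) _ that(2)] by (meson less_irrefl not_le)
  fix l :: real
  show "\<eta> \<le> \<rho>" if l: "1 \<le> l" and emb: "fock_embeds TYPE('n) l \<beta> \<rho> p \<eta> q"
  proof (cases "q < p")
    case True
    then show ?thesis using fock_embeds_weights_less[OF l assms(1,3) True emb] by simp
  next
    case False
    then have "1 / enn2real q \<le> 1 / enn2real p"
      using inv_less by (cases p q rule: linorder_cases) auto
    then have "real (2 * CARD('n)) * (l - 1) * (1 / enn2real q) \<le> real (2 * CARD('n)) * (l - 1) * (1 / enn2real p)"
      using l by (intro mult_left_mono) auto
    then show ?thesis using fock_embeds_peak_exponents[OF l assms emb] by simp
  qed
  show "fock_embeds TYPE('n) 1 \<beta> \<rho> p \<rho> q \<longleftrightarrow> p \<le> q"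
    using pq[of 1] fock_embeds_classical[OF assms(1,2)] by blast
  show "fock_embeds TYPE('n) l \<beta> \<rho> p \<rho> q \<longleftrightarrow> p = q" if l: "1 < l"
  proof
    assume emb: "fock_embeds TYPE('n) l \<beta> \<rho> p \<rho> q"
    have "\<not> p < q"
    proof
      assume "p < q"
      \<comment> \<open>The factor l - 1 is positive here, so the peak condition at equal weights
        fails strictly; at l = 1 it is void, in accordance with the classical embedding.\<close>
      then have "real (2 * CARD('n)) * (l - 1) * (1 / enn2real q) < real (2 * CARD('n)) * (l - 1) * (1 / enn2real p)"
        using l inv_less by (intro mult_strict_left_mono) auto
      then show False using fock_embeds_peak_exponents[OF less_imp_le[OF l] assms emb] by simp
    qed
    then show "p = q" using pq[OF less_imp_le[OF l] emb] by simp
  qed (auto simp: fock_embeds_refl)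
qed

end
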